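(* Let $k>1$ be an integer, and let the parameters $(p,\lambda)$ lie in $[0,1]\times[0,\infty)$. Let $(\hat p_n,\hat\lambda_n)$ be the maximum likelihood estimator of $(p,\lambda)$ based on $n$ repeated measurements $(X_{ij})_{1\le i\le k,\,1\le j\le n}$ over the time interval $[0,t]$, where the $X_{ij}$ are mutually independent with $X_{ij}\sim\mathrm{Poisson}(p(1-p)^{i-1}\lambda t)$. Let $\hat\chi_{n'}$ be an estimator of the constant $\chi$ based on $n'$ measurements, satisfying $\sqrt{n'}(\hat\chi_{n'}-\chi)\xrightarrow{d}\mathcal N(0,\sigma_\chi^2)$ as $n'\to\infty$. Let $n'=\lceil\gamma n\rceil$ with $\gamma>0$, where $\lceil\gamma n\rceil$ is the smallest integer not less than $\gamma n$. Put $\mu(p,\chi)=-\log(1-p)/\chi$ and $\mu=\mu(p,\chi)$. Then the plug-in estimator $\hat\mu=\mu(\hat p_n,\hat\chi_{n'})$ of $\mu$ is asymptotically normal: $$\sqrt n(\hat\mu-\mu)\xrightarrow{d}\mathcal N(0,\sigma_\mu^2)\quad\text{as } n\to\infty,$$ with $$\sigma_\mu^2=\Big[\frac{\partial\mu}{\partial p}(p,\chi)\Big]^2\sigma_p^2(p,\lambda)+\frac1\gamma\Big[\frac{\partial\mu}{\partial\chi}(p,\chi)\Big]^2\sigma_\chi^2 ,$$ where $\sigma_p^2(p,\lambda)$ is the asymptotic variance of $\sqrt n(\hat p_n-p)$, given by $$\sigma_p^2(p,\lambda)=\frac{(1-(1-p)^k)(1-p)p^2}{\lambda t\,q(p,k)},$$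 $$q(p,k)=(1-p)^{2k}-k^2(1-p)^{k+1}+2(k^2-1)(1-p)^k-k^2(1-p)^{k-1}+1.$$
   Context: Setting: $p$ is the probability that a neutron is absorbed at a layer of a $k$-layer detector, $\lambda$ is the intensity of the incoming Poisson process of neutrons, $t$ is the duration of each experiment, and $X_{ij}$ is the number of neutrons detected at layer $i$ in experiment round $j$. The wavelength $\mu$ of the beam satisfies $p=1-e^{-\chi\mu}$, where $\chi=\rho_{at}d_l\varsigma$, with $\rho_{at}$ (atomic density) and $d_l$ (layer thickness) known. The coefficient $\varsigma$ has been measured experimentally: its estimator $\hat\varsigma_{n'}$, based on $n'$ runs of an experiment, is unbiased and satisfies $\sqrt{n'}(\hat\varsigma_{n'}-\varsigma)\xrightarrow{d}\mathcal N(0,\sigma_\varsigma^2)$. Then $\hat\chi_{n'}=\rho_{at}d_l\hat\varsigma_{n'}$ and $\sigma_\chi^2=\rho_{at}^2d_l^2\sigma_\varsigma^2$. Maximum likelihood estimator: put $s_n=\frac1n\sum_{j=1}^n\sum_{i=1}^kX_{ij}$ and $z_n=\frac1n\sum_{j=1}^n\sum_{i=1}^k(i-1)X_{ij}$. Then $(\hat p_n,\hat\lambda_n)$ is the solution $(p,\lambda)$ of the score equations $$\frac{s_n-\lambda t(1-(1-p)^k)}{\lambda}=0,\qquad \frac{(1-p)(s_n+z_n)-z_n-\lambda t\,(k(1-p)^k-k(1-p)^{k+1})}{p(1-p)}=0,$$ where it is assumed that $\hat p_n(1-\hat p_n)\ne0$ and $\hat\lambda_n\neq0$.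
   Formalization: The estimators of χ are assumed independent of the counts X_ij (without this the additive variance formula fails), and 0<p<1, λ>0, t>0, χ≠0 are assumed, since the variance or μ is undefined otherwise. *)

theory Defs
  imports "HOL-Probability.Probability"
begin

text \<open>The normal law parametrised by its variance; a zero variance gives the point mass.\<close>

definition normal_law :: "real \<Rightarrow> real \<Rightarrow> real measure" where
  "normal_law m v =
     (if v = 0 then return borel m else density lborel (normal_density m (sqrt v)))"

definition converges_to_normal ::
    "'a measure \<Rightarrow> (nat \<Rightarrow> 'a \<Rightarrow> real) \<Rightarrow> real \<Rightarrow> bool" where
  "converges_to_normal M Y v \<longleftrightarrow> weak_conv_m (\<lambda>n. distr M borel (Y n)) (normal_law 0 v)"

text \<open>Independence of two random variables whose value types may differ, through the
  sigma-algebras they generate (\<^const>\<open>prob_space.indep_var\<close> requires equal value types).\<close>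

definition indep_rvs ::
    "'a measure \<Rightarrow> 'b measure \<Rightarrow> ('a \<Rightarrow> 'b) \<Rightarrow> 'c measure \<Rightarrow> ('a \<Rightarrow> 'c) \<Rightarrow> bool" where
  "indep_rvs M N1 U N2 V \<longleftrightarrow>
     prob_space.indep_set M (sets (vimage_algebra (space M) U N1))
                            (sets (vimage_algebra (space M) V N2))"

definition s_stat :: "nat \<Rightarrow> (nat \<Rightarrow> nat \<Rightarrow> 'a \<Rightarrow> nat) \<Rightarrow> nat \<Rightarrow> 'a \<Rightarrow> real" where
  "s_stat k X n \<omega> = 1 / real n * (\<Sum>j=1..n. \<Sum>i=1..k. real (X i j \<omega>))"

definition z_stat :: "nat \<Rightarrow> (nat \<Rightarrow> nat \<Rightarrow> 'a \<Rightarrow> nat) \<Rightarrow> nat \<Rightarrow> 'a \<Rightarrow> real" where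
  "z_stat k X n \<omega> = 1 / real n * (\<Sum>j=1..n. \<Sum>i=1..k. (real i - 1) * real (X i j \<omega>))"

text \<open>The pair \<open>(p, l)\<close> lies in the parameter space, is nondegenerate, and is a zero of the
  gradient of the log-likelihood of the data with statistics \<open>s\<close>, \<open>z\<close>.\<close>

definition solves_score :: "nat \<Rightarrow> real \<Rightarrow> real \<Rightarrow> real \<Rightarrow> real \<Rightarrow> real \<Rightarrow> bool" where
  "solves_score k t s z p l \<longleftrightarrow>
     p \<in> {0..1} \<and> l \<in> {0..} \<and> p * (1 - p) \<noteq> 0 \<and> l \<noteq> 0 \<and>
     (s - l * t * (1 - (1 - p) ^ k)) / l = 0 \<and>
     ((1 - p) * (s + z) - z - l * t * (real k * (1 - p) ^ k - real k * (1 - p) ^ (k + 1)))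
       / (p * (1 - p)) = 0"

text \<open>With positive probability (for instance when nothing is detected) the score equations
  have no solution; on that event the values of the estimator are left unspecified.\<close>

definition is_mle ::
    "'a measure \<Rightarrow> nat \<Rightarrow> real \<Rightarrow> (nat \<Rightarrow> nat \<Rightarrow> 'a \<Rightarrow> nat) \<Rightarrow> nat \<Rightarrow>
     ('a \<Rightarrow> real) \<Rightarrow> ('a \<Rightarrow> real) \<Rightarrow> bool" where
  "is_mle M k t X n P L \<longleftrightarrow>
     P \<in> borel_measurable M \<and> L \<in> borel_measurable M \<and>
     (\<forall>\<omega>\<in>space M.
        (\<exists>p l. solves_score k t (s_stat k X n \<omega>) (z_stat k X n \<omega>) p l) \<longrightarrow>
        solves_score k t (s_stat k X n \<omega>) (z_stat k X n \<omega>) (P \<omega>) (L \<omega>))"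

definition wavelength :: "real \<Rightarrow> real \<Rightarrow> real" where
  "wavelength p c = - ln (1 - p) / c"

definition q_poly :: "real \<Rightarrow> nat \<Rightarrow> real" where
  "q_poly p k = (1 - p) ^ (2 * k) - (real k)\<^sup>2 * (1 - p) ^ (k + 1)
     + 2 * ((real k)\<^sup>2 - 1) * (1 - p) ^ k - (real k)\<^sup>2 * (1 - p) ^ (k - 1) + 1"

definition var_p :: "nat \<Rightarrow> real \<Rightarrow> real \<Rightarrow> real \<Rightarrow> real" where
  "var_p k t p l = (1 - (1 - p) ^ k) * (1 - p) * p\<^sup>2 / (l * t * q_poly p k)"

definition var_wavelength ::
    "nat \<Rightarrow> real \<Rightarrow> real \<Rightarrow> real \<Rightarrow> real \<Rightarrow> real \<Rightarrow> real \<Rightarrow> real" where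
  "var_wavelength k t p l c v g =
     (deriv (\<lambda>x. wavelength x c) p)\<^sup>2 * var_p k t p l
     + 1 / g * (deriv (\<lambda>y. wavelength p y) c)\<^sup>2 * v"

end

theory Submission
  imports Defs "HOL-Real_Asymp.Real_Asymp"
begin

text \<open>
  Put \<open>x = 1 - p\<close>. The score equations say that \<open>z\<^sub>n / s\<^sub>n = g(x)\<close>, where
  \<open>g(y) = y / (1 - y) - k y\<^sup>k / (1 - y\<^sup>k)\<close> is the mean of the geometric law truncated to
  \<open>{0, \<dots>, k - 1}\<close>; its derivative is \<open>1 / y\<close> times the variance of that law, so \<open>g\<close> is strictly
  increasing and the root is unique. With \<open>r = g(1 - p)\<close>, the difference \<open>z\<^sub>n / s\<^sub>n - r\<close> equals
  \<open>(z\<^sub>n - r s\<^sub>n) / s\<^sub>n\<close>, whose numerator is a centred linear statistic \<open>W\<^sub>n / \<surd>n\<close> of the independent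
  Poisson counts, and the characteristic function of \<open>W\<^sub>n\<close> converges by direct computation. Difference
  quotients of \<open>g\<close> and of \<open>ln\<close> then give, outside events of vanishing probability,
  \<open>\<surd>n (\<mu>\<^sub>n - \<mu>) = a\<^sub>n W\<^sub>n + b\<^sub>n Y\<^sub>n\<close> with \<open>Y\<^sub>n = \<surd>n' (\<chi>\<^sub>n - \<chi>)\<close> independent of \<open>W\<^sub>n\<close> and with \<open>a\<^sub>n\<close>, \<open>b\<^sub>n\<close>
  converging in probability to constants, so Slutsky's theorem applies.
\<close>

section \<open>Convergence in probability and asymptotic normality\<close>

text \<open>Along this filter a property holds eventually iff the outer probability of its failure at stage
  \<open>n\<close> tends to \<open>0\<close>, so convergence in probability, even of non-measurable functions, is an ordinary
  filter limit and the library's limit rules apply to it.\<close>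

definition whp :: "'a measure \<Rightarrow> (nat \<times> 'a) filter" where
  "whp M = Abs_filter (\<lambda>P. \<forall>d>0. \<forall>\<^sub>F n in sequentially.
     \<exists>A\<in>sets M. measure M A < d \<and> (\<forall>\<omega>\<in>space M - A. P (n, \<omega>)))"

text \<open>The predicate in the definition really is a filter: to combine two properties, take
  exceptional events of probability below \<open>d / 2\<close> for each and unite them.\<close>

lemma eventually_whp:
  assumes "prob_space M"
  shows "eventually P (whp M) \<longleftrightarrow> (\<forall>d>0. \<forall>\<^sub>F n in sequentially.
     \<exists>A\<in>sets M. measure M A < d \<and> (\<forall>\<omega>\<in>space M - A. P (n, \<omega>)))"
  unfolding whp_def
proof (rule eventually_Abs_filter, unfold_locales, goal_cases)
  case 1
  show ?case by (auto intro!: always_eventually bexI[of _ "{}"])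
next
  case (2 P Q)
  interpret prob_space M by fact
  show ?case
  proof (intro allI impI)
    fix d :: real assume "d > 0"
    then have "d / 2 > 0" by simp
    with 2 have
      "\<forall>\<^sub>F n in sequentially. \<exists>A\<in>sets M. prob A < d / 2 \<and> (\<forall>\<omega>\<in>space M - A. P (n, \<omega>))"
      "\<forall>\<^sub>F n in sequentially. \<exists>A\<in>sets M. prob A < d / 2 \<and> (\<forall>\<omega>\<in>space M - A. Q (n, \<omega>))"
      by blast+
    then show "\<forall>\<^sub>F n in sequentially. \<exists>A\<in>sets M. prob A < d \<and>
        (\<forall>\<omega>\<in>space M - A. P (n, \<omega>) \<and> Q (n, \<omega>))"
    proof eventually_elim
      case (elim n)
      then obtain A B where AB: "A \<in> sets M" "B \<in> sets M" "prob A < d / 2" "prob B < d / 2"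
        "\<forall>\<omega>\<in>space M - A. P (n, \<omega>)" "\<forall>\<omega>\<in>space M - B. Q (n, \<omega>)" by blast
      moreover have "prob (A \<union> B) \<le> prob A + prob B" using AB by (intro measure_Un_le) auto
      ultimately show ?case by (intro bexI[of _ "A \<union> B"]) auto
    qed
  qed
next
  case (3 P Q)
  show ?case
  proof (intro allI impI)
    fix d :: real assume "d > 0"
    then have "\<forall>\<^sub>F n in sequentially. \<exists>A\<in>sets M. measure M A < d \<and> (\<forall>\<omega>\<in>space M - A. P (n, \<omega>))"
      using 3 by blast
    then show "\<forall>\<^sub>F n in sequentially. \<exists>A\<in>sets M. measure M A < d \<and> (\<forall>\<omega>\<in>space M - A. Q (n, \<omega>))"
      by eventually_elim (use 3 in blast)
  qed
qed

lemma eventually_whpI_sequentially: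
  assumes "prob_space M" "\<forall>\<^sub>F n in sequentially. \<forall>\<omega>\<in>space M. P (n, \<omega>)"
  shows "eventually P (whp M)"
proof -
  interpret prob_space M by fact
  show ?thesis unfolding eventually_whp[OF assms(1)]
    using assms(2) by (auto elim!: eventually_mono intro!: bexI[of _ "{}"])
qed

lemma tendsto_whp_const:
  assumes "prob_space M" "a \<longlonglongrightarrow> l"
  shows "((\<lambda>(n, \<omega>). a n) \<longlongrightarrow> l) (whp M)"
  unfolding tendsto_def
  using assms(2)
  by (auto simp: case_prod_beta tendsto_def intro!: eventually_whpI_sequentially[OF assms(1)] elim!: eventually_mono)

section \<open>Normal laws through characteristic functions, and tightness\<close>

text \<open>Massless endpoints make the interval a continuity set, so weak convergence carries over
  its measure. Such a \<open>K\<close> exists because a probability law has only countably many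
  atoms.\<close>

lemma real_distribution_symmetric_interval:
  assumes "real_distribution N" "d > 0"
  shows "\<exists>K>0. measure N {-K..K} > 1 - d \<and> measure N {-K} = 0 \<and> measure N {K} = 0"
proof -
  interpret real_distribution N by fact
  have "(\<lambda>n. measure N {- real n..real n}) \<longlonglongrightarrow> measure N (\<Union>n. {- real n..real n})"
    by (rule finite_Lim_measure_incseq) (auto simp: incseq_def)
  also have "(\<Union>n. {- real n..real n}) = UNIV"
  proof (rule UNIV_eq_I[symmetric])
    fix x :: real
    obtain n where "\<bar>x\<bar> \<le> real n" using real_arch_simple by blast
    then have "x \<in> {- real n..real n}" by auto
    then show "x \<in> (\<Union>n. {- real n..real n})" by blast
  qed
  also have "measure N UNIV = 1" using prob_space by simp
  finally have "\<forall>\<^sub>F n in sequentially. measure N {- real n..real n} > 1 - d"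
    by (rule order_tendstoD) (use assms in auto)
  then obtain n where n: "measure N {- real n..real n} > 1 - d"
    by (auto simp: eventually_sequentially)
  \<comment> \<open>The reflected atoms are included so that a single \<open>K\<close> outside this
    countable set avoids atoms at both \<open>K\<close> and \<open>-K\<close>.\<close>
  let ?C = "{x. measure N {x} \<noteq> 0} \<union> uminus ` {x. measure N {x} \<noteq> 0}"
  have "countable ?C" using countable_support by auto
  moreover have "uncountable {real n<..<real n + 1}" by (rule uncountable_open_interval[THEN iffD2]) simp
  ultimately have "\<not> {real n<..<real n + 1} \<subseteq> ?C" using countable_subset by blast
  then obtain K where K: "real n < K" "measure N {K} = 0" "K \<notin> uminus ` {x. measure N {x} \<noteq> 0}" by auto
  have "measure N {-K} = 0" using K(3) by (metis (mono_tags, lifting) image_eqI mem_Collect_eq minus_minus)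
  moreover have "measure N {- real n..real n} \<le> measure N {-K..K}"
    using K by (intro finite_measure_mono) auto
  ultimately show ?thesis using n K by (intro exI[of _ K]) auto
qed

lemma real_distribution_normal_law:
  assumes "v \<ge> 0" shows "real_distribution (normal_law m v)"
proof (cases "v = 0")
  case True
  then show ?thesis by (auto simp: normal_law_def real_distribution_def real_distribution_axioms_def
    intro!: prob_space_return)
next
  case False
  then show ?thesis using assms by (auto simp: normal_law_def real_distribution_def real_distribution_axioms_def
    intro!: prob_space_normal_density)
qed

text \<open>Positive variance reduces to the standard normal law by scaling. The point mass has
  constant characteristic function 1, so one formula covers the degenerate case too.\<close>

lemma char_normal_law:
  assumes "v \<ge> 0" shows "char (normal_law 0 v) s = complex_of_real (exp (- v * s\<^sup>2 / 2))"
proof (cases "v = 0")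
  case True
  have "integral\<^sup>L (return borel (0::real)) (\<lambda>x. iexp (s * x)) = 1"
    by (subst integral_return) auto
  then show ?thesis using True by (simp add: normal_law_def char_def)
next
  case False
  with assms have v: "v > 0" by simp
  interpret S: real_distribution std_normal_distribution by (rule real_dist_normal_dist)
  have "distributed std_normal_distribution lborel (\<lambda>x. x) std_normal_density"
    by (auto simp: distributed_def distr_id2)
  from S.normal_density_affine[OF this, of "sqrt v" 0]
  have "distributed std_normal_distribution lborel (\<lambda>x. sqrt v * x) (normal_density 0 (sqrt v))"
    using v by simp
  then have d: "normal_law 0 v = distr std_normal_distribution borel (\<lambda>x. sqrt v * x)"
    using v by (simp add: normal_law_def distributed_def cong: distr_cong)
  have "char (normal_law 0 v) s = (LINT x|std_normal_distribution. iexp (s * (sqrt v * x)))"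
    unfolding d char_def by (subst integral_distr) (auto)
  also have "\<dots> = char std_normal_distribution (s * sqrt v)"
    by (simp add: char_def mult.assoc)
  also have "\<dots> = complex_of_real (exp (- v * s\<^sup>2 / 2))"
    using v by (simp add: char_std_normal_distribution power_mult_distrib mult.commute)
  finally show ?thesis .
qed

text \<open>Levy's continuity theorem in both directions; most closure properties below are thereby
  reduced to limits of complex numbers.\<close>

lemma converges_to_normal_iff_char:
  assumes "prob_space M" "v \<ge> 0" and [measurable]: "\<And>n. Y n \<in> borel_measurable M"
  shows "converges_to_normal M Y v \<longleftrightarrow>
    (\<forall>s. (\<lambda>n. char (distr M borel (Y n)) s) \<longlonglongrightarrow> complex_of_real (exp (- v * s\<^sup>2 / 2)))"
proof -
  interpret prob_space M by fact
  have rd: "real_distribution (distr M borel (Y n))" for n by simp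
  note rn = real_distribution_normal_law[OF assms(2), of 0]
  show ?thesis
    unfolding converges_to_normal_def char_normal_law[OF assms(2), symmetric]
    using levy_continuity1[where M = "\<lambda>n. distr M borel (Y n)", OF rd rn]
      levy_continuity[where M = "\<lambda>n. distr M borel (Y n)", OF rd rn] by blast
qed

text \<open>The limit law puts almost all its mass on an interval with massless endpoints, and by
  weak convergence so do the laws of \<open>Y n\<close> for large \<open>n\<close>.\<close>

lemma converges_to_normal_tight:
  assumes "prob_space M" "v \<ge> 0" and [measurable]: "\<And>n. Y n \<in> borel_measurable M"
    and "converges_to_normal M Y v" and "d > 0"
  shows "\<exists>K>0. \<forall>\<^sub>F n in sequentially. measure M {\<omega>\<in>space M. \<bar>Y n \<omega>\<bar> > K} < d"
proof -
  interpret prob_space M by fact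
  have rd: "real_distribution (distr M borel (Y n))" for n by simp
  note rn = real_distribution_normal_law[OF assms(2), of 0]
  interpret N: real_distribution "normal_law 0 v" by (rule rn)
  obtain K where K: "K > 0" "measure (normal_law 0 v) {-K..K} > 1 - d"
    "measure (normal_law 0 v) {-K} = 0" "measure (normal_law 0 v) {K} = 0"
    using real_distribution_symmetric_interval[OF rn assms(5)] by blast
  have "measure (normal_law 0 v) ({-K} \<union> {K}) \<le> 0"
    using measure_Un_le[of "{-K}" "normal_law 0 v" "{K}"] K by simp
  moreover have "frontier {-K..K} = {-K} \<union> {K}" using K by (auto simp: frontier_def)
  ultimately have "emeasure (normal_law 0 v) (frontier {-K..K}) = 0"
    by (simp add: N.emeasure_eq_measure measure_le_0_iff)
  with weak_conv_imp_continuity_set_conv[where \<mu> = "\<lambda>n. distr M borel (Y n)",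
      OF rd rn assms(4)[unfolded converges_to_normal_def], of "{-K..K}"]
  have "(\<lambda>n. measure (distr M borel (Y n)) {-K..K}) \<longlonglongrightarrow> measure (normal_law 0 v) {-K..K}"
    by simp
  then have "\<forall>\<^sub>F n in sequentially. measure (distr M borel (Y n)) {-K..K} > 1 - d"
    using K(2) by (rule order_tendstoD)
  then have "\<forall>\<^sub>F n in sequentially. measure M {\<omega>\<in>space M. \<bar>Y n \<omega>\<bar> > K} < d"
  proof eventually_elim
    case (elim n)
    have "{\<omega>\<in>space M. \<bar>Y n \<omega>\<bar> > K} = space M - (Y n -` {-K..K} \<inter> space M)" by auto
    then show ?case using elim by (simp add: prob_compl measure_distr)
  qed
  then show ?thesis using K by blast
qed

text \<open>By tightness \<open>Y n\<close> is bounded by some \<open>K\<close> off a small event,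
  and \<open>f n\<close> is below \<open>e / K\<close> off another. Measurability of
  \<open>f\<close> is not involved, which suits difference quotients evaluated at an
  estimator.\<close>

lemma converges_to_normal_times_vanishing:
  assumes "prob_space M" "v \<ge> 0" and [measurable]: "\<And>n. Y n \<in> borel_measurable M"
    and "converges_to_normal M Y v" and f: "((\<lambda>(n, \<omega>). f n \<omega>) \<longlongrightarrow> (0::real)) (whp M)"
  shows "((\<lambda>(n, \<omega>). f n \<omega> * Y n \<omega>) \<longlongrightarrow> 0) (whp M)"
proof (rule tendstoI)
  interpret prob_space M by fact
  fix e :: real assume e: "e > 0"
  show "\<forall>\<^sub>F x in whp M. dist (case x of (n, \<omega>) \<Rightarrow> f n \<omega> * Y n \<omega>) 0 < e"
    unfolding eventually_whp[OF assms(1)]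
  proof (intro allI impI)
    fix d :: real assume "d > 0"
    then have d: "d / 2 > 0" by simp
    obtain K where K: "K > 0" "\<forall>\<^sub>F n in sequentially. prob {\<omega>\<in>space M. \<bar>Y n \<omega>\<bar> > K} < d / 2"
      using converges_to_normal_tight[OF assms(1-4) d] by blast
    have "e / K > 0" using e K by simp
    from tendstoD[OF f this]
    have "\<forall>d>0. \<forall>\<^sub>F n in sequentially. \<exists>A\<in>events. prob A < d \<and> (\<forall>\<omega>\<in>space M - A. \<bar>f n \<omega>\<bar> < e / K)"
      unfolding eventually_whp[OF assms(1)] by simp
    from K(2) this[rule_format, OF d] show "\<forall>\<^sub>F n in sequentially. \<exists>A\<in>events. prob A < d \<and>
        (\<forall>\<omega>\<in>space M - A. dist (case (n, \<omega>) of (n, \<omega>) \<Rightarrow> f n \<omega> * Y n \<omega>) 0 < e)"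
    proof eventually_elim
      case (elim n)
      then obtain A where A: "A \<in> events" "prob A < d / 2" "\<forall>\<omega>\<in>space M - A. \<bar>f n \<omega>\<bar> < e / K" by blast
      let ?B = "A \<union> {\<omega>\<in>space M. \<bar>Y n \<omega>\<bar> > K}"
      have "prob ?B \<le> prob A + prob {\<omega>\<in>space M. \<bar>Y n \<omega>\<bar> > K}" using A by (intro measure_Un_le) auto
      then have "prob ?B < d" using A elim by simp
      moreover have "\<bar>f n \<omega>\<bar> * \<bar>Y n \<omega>\<bar> < e" if "\<omega> \<in> space M - ?B" for \<omega>
      proof -
        have "\<bar>f n \<omega>\<bar> < e / K" "\<bar>Y n \<omega>\<bar> \<le> K" using that A by auto
        then have "\<bar>f n \<omega>\<bar> * \<bar>Y n \<omega>\<bar> \<le> \<bar>f n \<omega>\<bar> * K" "\<bar>f n \<omega>\<bar> * K < e"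
          using K by (auto intro!: mult_left_mono simp: pos_less_divide_eq)
        then show ?thesis by simp
      qed
      ultimately show ?case using A by (intro bexI[of _ ?B]) (auto simp: abs_mult)
    qed
  qed
qed

section \<open>Slutsky's theorem and random linear combinations\<close>

lemma norm_iexp_diff_le: "cmod (iexp a - iexp b) \<le> \<bar>a - b\<bar>"
proof -
  have "iexp a - iexp b = iexp b * (iexp (a - b) - 1)"
    by (simp add: right_diff_distrib exp_add[symmetric] algebra_simps)
  then have "cmod (iexp a - iexp b) = cmod (iexp (a - b) - 1)" by (simp add: norm_mult)
  also have "\<dots> \<le> \<bar>a - b\<bar>" using iexp_approx1[of "a - b" 0] by simp
  finally show ?thesis .
qed

text \<open>The characteristic functions differ by at most the mean of
  \<open>cmod (iexp (s * Z n \<omega>) - iexp (s * Y n \<omega>))\<close>: the Lipschitz bound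
  controls it where the variables are close, the trivial bound 2 on the exceptional event.\<close>

lemma converges_to_normal_Slutsky:
  assumes "prob_space M" "v \<ge> 0" and Y[measurable]: "\<And>n. Y n \<in> borel_measurable M"
    and Z[measurable]: "\<And>n. Z n \<in> borel_measurable M"
    and "converges_to_normal M Y v" and f: "((\<lambda>(n, \<omega>). Z n \<omega> - Y n \<omega>) \<longlongrightarrow> 0) (whp M)"
  shows "converges_to_normal M Z v"
  unfolding converges_to_normal_iff_char[OF assms(1,2) Z]
proof
  interpret prob_space M by fact
  fix s :: real
  have "(\<lambda>n. char (distr M borel (Z n)) s - char (distr M borel (Y n)) s) \<longlonglongrightarrow> 0"
  proof (rule tendstoI)
    fix e :: real assume e: "e > 0"
    \<comment> \<open>With this \<open>h\<close> the Lipschitz part costs at most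
      \<open>e / 2\<close>; the event of probability below \<open>e / 4\<close>, counted twice,
      costs less than the other half. The added 1 covers \<open>s = 0\<close>.\<close>
    define h where "h = e / (2 * (\<bar>s\<bar> + 1))"
    have h: "h > 0" "\<bar>s\<bar> * h \<le> e / 2" using e by (auto simp: h_def field_simps)
    from tendstoD[OF f h(1)]
    have "\<forall>d>0. \<forall>\<^sub>F n in sequentially. \<exists>A\<in>events. prob A < d \<and> (\<forall>\<omega>\<in>space M - A. \<bar>Z n \<omega> - Y n \<omega>\<bar> < h)"
      unfolding eventually_whp[OF assms(1)] by simp
    moreover have "e / 4 > 0" using e by simp
    ultimately have "\<forall>\<^sub>F n in sequentially. \<exists>A\<in>events. prob A < e / 4 \<and> (\<forall>\<omega>\<in>space M - A. \<bar>Z n \<omega> - Y n \<omega>\<bar> < h)"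
      by blast
    then show "\<forall>\<^sub>F n in sequentially. dist (char (distr M borel (Z n)) s - char (distr M borel (Y n)) s) 0 < e"
    proof eventually_elim
      case (elim n)
      then obtain A where A[measurable]: "A \<in> events" and
        A': "prob A < e / 4" "\<forall>\<omega>\<in>space M - A. \<bar>Z n \<omega> - Y n \<omega>\<bar> < h" by blast
      have int: "integrable M (\<lambda>\<omega>. iexp (s * Z n \<omega>))" "integrable M (\<lambda>\<omega>. iexp (s * Y n \<omega>))"
        by (auto intro!: integrable_const_bound[where B=1])
      have "char (distr M borel (Z n)) s - char (distr M borel (Y n)) s
          = (LINT \<omega>|M. iexp (s * Z n \<omega>) - iexp (s * Y n \<omega>))"
        using int by (simp add: char_def integral_distr)
      also have "cmod \<dots> \<le> (LINT \<omega>|M. cmod (iexp (s * Z n \<omega>) - iexp (s * Y n \<omega>)))"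
        by (rule integral_norm_bound)
      also have "\<dots> \<le> (LINT \<omega>|M. \<bar>s\<bar> * h + 2 * indicator A \<omega>)"
      proof (rule integral_mono_AE)
        show "integrable M (\<lambda>\<omega>. cmod (iexp (s * Z n \<omega>) - iexp (s * Y n \<omega>)))"
          using int by auto
        show "integrable M (\<lambda>\<omega>. \<bar>s\<bar> * h + 2 * indicator A \<omega>)" by (auto simp: emeasure_eq_measure)
        show "AE \<omega> in M. cmod (iexp (s * Z n \<omega>) - iexp (s * Y n \<omega>)) \<le> \<bar>s\<bar> * h + 2 * indicator A \<omega>"
        proof (rule AE_I2)
          fix \<omega> assume w: "\<omega> \<in> space M"
          show "cmod (iexp (s * Z n \<omega>) - iexp (s * Y n \<omega>)) \<le> \<bar>s\<bar> * h + 2 * indicator A \<omega>"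
          proof (cases "\<omega> \<in> A")
            case True
            have "cmod (iexp (s * Z n \<omega>) - iexp (s * Y n \<omega>)) \<le> 2"
              using norm_triangle_ineq4[of "iexp (s * Z n \<omega>)" "iexp (s * Y n \<omega>)"] by simp
            moreover have "\<bar>s\<bar> * h \<ge> 0" using h by simp
            ultimately show ?thesis using True by simp
          next
            case False
            have "cmod (iexp (s * Z n \<omega>) - iexp (s * Y n \<omega>)) \<le> \<bar>s * Z n \<omega> - s * Y n \<omega>\<bar>"
              by (rule norm_iexp_diff_le)
            also have "\<dots> = \<bar>s\<bar> * \<bar>Z n \<omega> - Y n \<omega>\<bar>" by (simp add: right_diff_distrib[symmetric] abs_mult)
            also have "\<dots> \<le> \<bar>s\<bar> * h" using A'(2) False w by (intro mult_left_mono) (auto intro: less_imp_le)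
            finally show ?thesis using False by simp
          qed
        qed
      qed
      also have "\<dots> = \<bar>s\<bar> * h + 2 * prob A" by (simp add: emeasure_eq_measure prob_space)
      also have "\<dots> < e" using h A' by simp
      finally show ?case by simp
    qed
  qed
  moreover have "(\<lambda>n. char (distr M borel (Y n)) s) \<longlonglongrightarrow> complex_of_real (exp (- v * s\<^sup>2 / 2))"
    using assms(5) unfolding converges_to_normal_iff_char[OF assms(1,2) Y] by blast
  ultimately show "(\<lambda>n. char (distr M borel (Z n)) s) \<longlonglongrightarrow> complex_of_real (exp (- v * s\<^sup>2 / 2))"
    using tendsto_add by fastforce
qed

lemma converges_to_normal_cmult:
  assumes "prob_space M" "v \<ge> 0" and Y[measurable]: "\<And>n. Y n \<in> borel_measurable M"
    and "converges_to_normal M Y v"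
  shows "converges_to_normal M (\<lambda>n \<omega>. c * Y n \<omega>) (c\<^sup>2 * v)"
proof -
  interpret prob_space M by fact
  have "char (distr M borel (\<lambda>\<omega>. c * Y n \<omega>)) s = char (distr M borel (Y n)) (s * c)" for n s
    by (simp add: char_def integral_distr mult.assoc)
  moreover have "(\<lambda>n. char (distr M borel (Y n)) (s * c)) \<longlonglongrightarrow> complex_of_real (exp (- v * (s * c)\<^sup>2 / 2))" for s
    using assms(4) unfolding converges_to_normal_iff_char[OF assms(1,2) Y] by blast
  moreover have "v * (s * c)\<^sup>2 = (c\<^sup>2 * v) * s\<^sup>2" for s by (simp add: power_mult_distrib)
  ultimately show ?thesis
    using assms(2) by (subst converges_to_normal_iff_char[OF assms(1)]) (auto simp: algebra_simps)
qed

lemma converges_to_normal_add_indep: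
  assumes "prob_space M" "u \<ge> 0" "v \<ge> 0"
    and U[measurable]: "\<And>n. U n \<in> borel_measurable M"
    and V[measurable]: "\<And>n. V n \<in> borel_measurable M"
    and "converges_to_normal M U u" "converges_to_normal M V v"
    and indep: "\<And>n. prob_space.indep_var M borel (U n) borel (V n)"
  shows "converges_to_normal M (\<lambda>n \<omega>. U n \<omega> + V n \<omega>) (u + v)"
proof -
  interpret prob_space M by fact
  have lim: "(\<lambda>n. char (distr M borel (U n)) s * char (distr M borel (V n)) s)
      \<longlonglongrightarrow> complex_of_real (exp (- u * s\<^sup>2 / 2)) * complex_of_real (exp (- v * s\<^sup>2 / 2))" for s
    using assms(6,7)
    unfolding converges_to_normal_iff_char[OF assms(1,2) U] converges_to_normal_iff_char[OF assms(1,3) V]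
    by (intro tendsto_mult) auto
  have "(\<lambda>n. char (distr M borel (\<lambda>\<omega>. U n \<omega> + V n \<omega>)) s)
      \<longlonglongrightarrow> complex_of_real (exp (- (u + v) * s\<^sup>2 / 2))" for s
    using lim[of s] unfolding char_distr_add[OF indep]
    by (simp add: of_real_mult[symmetric] exp_add[symmetric] algebra_simps add_divide_distrib diff_divide_distrib del: of_real_mult)
  then show ?thesis using assms(2,3) by (subst converges_to_normal_iff_char[OF assms(1)]) auto
qed

text \<open>Both conclusions of the theorem are instances of this. Replacing \<open>a\<close> and
  \<open>b\<close> by their limits creates the errors
  \<open>(a n \<omega> - \<alpha>) * U n \<omega>\<close> and
  \<open>(b n \<omega> - \<beta>) * V n \<omega>\<close>, which vanish by tightness; the constant
  combination is handled by independence.\<close>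

lemma converges_to_normal_random_combination:
  assumes "prob_space M" "u \<ge> 0" "v \<ge> 0"
    and U[measurable]: "\<And>n. U n \<in> borel_measurable M"
    and V[measurable]: "\<And>n. V n \<in> borel_measurable M"
    and T[measurable]: "\<And>n. T n \<in> borel_measurable M"
    and cU: "converges_to_normal M U u" and cV: "converges_to_normal M V v"
    and indep: "\<And>n. prob_space.indep_var M borel (U n) borel (V n)"
    and a: "((\<lambda>(n, \<omega>). a n \<omega>) \<longlongrightarrow> \<alpha>) (whp M)"
    and b: "((\<lambda>(n, \<omega>). b n \<omega>) \<longlongrightarrow> \<beta>) (whp M)"
    and eq: "\<forall>\<^sub>F (n, \<omega>) in whp M. T n \<omega> = a n \<omega> * U n \<omega> + b n \<omega> * V n \<omega>"
  shows "converges_to_normal M T (\<alpha>\<^sup>2 * u + \<beta>\<^sup>2 * v)"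
proof (rule converges_to_normal_Slutsky[OF assms(1)])
  interpret prob_space M by fact
  have "indep_var borel ((\<lambda>x. \<alpha> * x) \<circ> U n) borel ((\<lambda>x. \<beta> * x) \<circ> V n)" for n
    by (rule indep_var_compose[OF indep]) auto
  then show "converges_to_normal M (\<lambda>n \<omega>. \<alpha> * U n \<omega> + \<beta> * V n \<omega>) (\<alpha>\<^sup>2 * u + \<beta>\<^sup>2 * v)"
    using assms(2,3) cU cV
    by (intro converges_to_normal_add_indep converges_to_normal_cmult assms(1)) (auto simp: comp_def)
  have "((\<lambda>(n, \<omega>). (a n \<omega> - \<alpha>) * U n \<omega>) \<longlongrightarrow> 0) (whp M)"
    using tendsto_diff[OF a tendsto_const[of \<alpha>]] by (intro converges_to_normal_times_vanishing[OF assms(1,2) U cU])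
      (simp add: case_prod_beta')
  moreover have "((\<lambda>(n, \<omega>). (b n \<omega> - \<beta>) * V n \<omega>) \<longlongrightarrow> 0) (whp M)"
    using tendsto_diff[OF b tendsto_const[of \<beta>]] by (intro converges_to_normal_times_vanishing[OF assms(1,3) V cV])
      (simp add: case_prod_beta')
  ultimately have "((\<lambda>x. (\<lambda>(n, \<omega>). (a n \<omega> - \<alpha>) * U n \<omega>) x + (\<lambda>(n, \<omega>). (b n \<omega> - \<beta>) * V n \<omega>) x) \<longlongrightarrow> 0 + 0) (whp M)"
    by (rule tendsto_add)
  then have "((\<lambda>x. (\<lambda>(n, \<omega>). (a n \<omega> - \<alpha>) * U n \<omega>) x + (\<lambda>(n, \<omega>). (b n \<omega> - \<beta>) * V n \<omega>) x) \<longlongrightarrow> 0) (whp M)"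
    by simp
  then show "((\<lambda>(n, \<omega>). T n \<omega> - (\<alpha> * U n \<omega> + \<beta> * V n \<omega>)) \<longlongrightarrow> 0) (whp M)"
    by (rule Lim_transform_eventually)
       (use eq in \<open>auto simp: case_prod_beta algebra_simps elim!: eventually_mono\<close>)
qed (use assms in auto)

text \<open>\<open>N\<close> may repeat values, as rounding up does when
  \<open>\<gamma> < 1\<close>; only its divergence matters for composing limits of characteristic
  functions.\<close>

lemma converges_to_normal_subseq:
  assumes "prob_space M" "v \<ge> 0" and Y: "\<And>n. Y n \<in> borel_measurable M"
    and "converges_to_normal M Y v" and "filterlim N at_top sequentially"
  shows "converges_to_normal M (\<lambda>n. Y (N n)) v"
proof -
  have "(\<lambda>n. char (distr M borel (Y (N n))) s) \<longlonglongrightarrow> complex_of_real (exp (- v * s\<^sup>2 / 2))" for s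
    using assms(4) filterlim_compose[OF _ assms(5), of "\<lambda>n. char (distr M borel (Y n)) s"]
    unfolding converges_to_normal_iff_char[OF assms(1,2) Y] by blast
  then show ?thesis
    using Y by (subst converges_to_normal_iff_char[OF assms(1,2)]) auto
qed

lemma eventually_whp_index:
  assumes "prob_space M"
  shows "\<forall>\<^sub>F (n, \<omega>) in whp M. n \<ge> n0 \<and> \<omega> \<in> space M"
  by (rule eventually_whpI_sequentially[OF assms])
     (use eventually_ge_at_top[of n0] in \<open>auto elim: eventually_mono\<close>)

text \<open>This turns a central limit theorem into a weak law of large numbers, the source of all
  consistency statements below.\<close>

lemma converges_to_normal_div_sqrt_vanishes:
  assumes "prob_space M" "v \<ge> 0" "\<And>n. Y n \<in> borel_measurable M" "converges_to_normal M Y v"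
    and "filterlim N at_top sequentially"
  shows "((\<lambda>(n, \<omega>). Y n \<omega> / sqrt (real (N n))) \<longlongrightarrow> 0) (whp M)"
proof -
  have "filterlim (\<lambda>n. sqrt (real (N n))) at_top sequentially"
    using assms(5) by (intro filterlim_compose[OF sqrt_at_top] filterlim_compose[OF filterlim_real_sequentially])
  then have "(\<lambda>n. inverse (sqrt (real (N n)))) \<longlonglongrightarrow> 0"
    by (rule tendsto_inverse_0_at_top)
  from converges_to_normal_times_vanishing[OF assms(1-4) tendsto_whp_const[OF assms(1) this]]
  show ?thesis by (simp add: divide_inverse mult.commute)
qed

section \<open>Weighted sums of independent Poisson variables\<close>

text \<open>Summing against the Poisson weights gives the exponential series at
  \<open>m * iexp a\<close>, times \<open>exp (- m)\<close>.\<close>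

lemma char_poisson:
  assumes "m > 0"
  shows "(CLINT x|measure_pmf (poisson_pmf m). iexp (a * real x)) = exp (of_real m * (iexp a - 1))"
proof -
  define f :: "nat \<Rightarrow> complex" where "f = (\<lambda>x. of_real (m ^ x / fact x * exp (- m)) * iexp (a * real x))"
  have e: "(of_real m * iexp a) ^ x /\<^sub>R fact x * of_real (exp (- m)) = f x" for x
    by (simp add: f_def power_mult_distrib scaleR_conv_of_real exp_of_nat_mult[symmetric] field_simps)
  have "(\<lambda>x. (of_real m * iexp a) ^ x /\<^sub>R fact x * of_real (exp (- m))) sums (exp (of_real m * iexp a) * of_real (exp (- m)))"
    by (intro sums_mult2 exp_converges)
  then have sums: "f sums (exp (of_real m * iexp a) * of_real (exp (- m)))" unfolding e .
  have "norm (f x) = exp (- m) * (m ^ x /\<^sub>R fact x)" for x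
    using assms by (simp add: f_def norm_mult norm_divide norm_power norm_inverse norm_fact divide_inverse)
  then have "summable (\<lambda>x. norm (f x))"
    using summable_mult[OF summable_exp_generic[of m], of "exp (- m)"] by simp
  then have "integral\<^sup>L (count_space UNIV) f = suminf f"
    by (intro integral_count_space_nat) (simp add: integrable_count_space_nat_iff)
  also have "suminf f = exp (of_real m * iexp a) * of_real (exp (- m))" using sums by (rule sums_unique[symmetric])
  also have "\<dots> = exp (of_real m * (iexp a - 1))"
    by (simp add: exp_of_real[symmetric] exp_add[symmetric] algebra_simps)
  finally show ?thesis
    using assms unfolding measure_pmf_eq_density
    by (subst integral_density) (auto simp: f_def scaleR_conv_of_real)
qed

text \<open>With \<open>\<theta> = a / sqrt n\<close> the second-order Taylor term of
  \<open>iexp\<close> is \<open>- \<theta>^2 / 2\<close>, and \<open>n * \<theta>^2 = a^2\<close>.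
  Real and imaginary parts are treated separately.\<close>

lemma tendsto_poisson_exponent:
  "(\<lambda>n. of_nat n * (iexp (a / sqrt (real n)) - 1 - \<i> * of_real (a / sqrt (real n))))
     \<longlonglongrightarrow> of_real (- a\<^sup>2 / 2)"
proof -
  have "(\<lambda>n. real n * (cos (a / sqrt (real n)) - 1)) \<longlonglongrightarrow> - a\<^sup>2 / 2"
    "(\<lambda>n. real n * (sin (a / sqrt (real n)) - a / sqrt (real n))) \<longlonglongrightarrow> 0"
    by (real_asymp simp: power2_eq_square)+
  then show ?thesis
    by (subst tendsto_complex_iff) (simp add: exp_Euler Re_exp Im_exp)
qed

text \<open>The characteristic function of \<open>U n\<close> is an exact exponential, because
  Poisson characteristic functions are and independence multiplies them; the limit is taken in the
  exponent.\<close>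

lemma poisson_array_clt:
  fixes X :: "nat \<Rightarrow> nat \<Rightarrow> 'a \<Rightarrow> nat" and m c :: "nat \<Rightarrow> real"
  assumes "prob_space M"
    and indep: "prob_space.indep_vars M (\<lambda>_. count_space UNIV) (\<lambda>(i, j). X i j) ({1..k} \<times> {1..})"
    and distr: "\<And>i j. i \<in> {1..k} \<Longrightarrow> j \<ge> 1 \<Longrightarrow>
      distr M (count_space UNIV) (X i j) = measure_pmf (poisson_pmf (m i))"
    and m: "\<And>i. i \<in> {1..k} \<Longrightarrow> m i > 0"
  defines "U \<equiv> \<lambda>n \<omega>. (\<Sum>j=1..n. \<Sum>i=1..k. c i * (real (X i j \<omega>) - m i)) / sqrt (real n)"
  shows "converges_to_normal M U (\<Sum>i=1..k. (c i)\<^sup>2 * m i)"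
    and "U n \<in> borel_measurable M"
proof -
  interpret prob_space M by fact
  have X: "X i j \<in> measurable M (count_space UNIV)" if "i \<in> {1..k}" "j \<ge> 1" for i j
    using indep that by (auto simp: indep_vars_def)
  have U: "U n \<in> borel_measurable M" for n
    unfolding U_def
    by (intro borel_measurable_divide borel_measurable_sum borel_measurable_times borel_measurable_diff
        measurable_compose[OF X] borel_measurable_const) auto
  then show "U n \<in> borel_measurable M" .
  define Y where "Y n = (\<lambda>(i, j) \<omega>. c i * (real (X i j \<omega>) - m i) / sqrt (real n))" for n
  have U_eq: "U n = (\<lambda>\<omega>. \<Sum>x\<in>{1..k} \<times> {1..n}. Y n x \<omega>)" for n
    unfolding U_def Y_def sum_divide_distrib
    by (subst sum.swap) (simp add: sum.cartesian_product case_prod_beta')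
  have indep_Y: "indep_vars (\<lambda>_. borel) (Y n) ({1..k} \<times> {1..n})" for n
  proof -
    have "indep_vars (\<lambda>_. count_space UNIV) (\<lambda>(i, j). X i j) ({1..k} \<times> {1..n})"
      by (rule indep_vars_subset[OF indep]) auto
    then have "indep_vars (\<lambda>_. borel) (\<lambda>x \<omega>. (\<lambda>y. c (fst x) * (real y - m (fst x)) / sqrt (real n)) ((\<lambda>(i, j). X i j) x \<omega>)) ({1..k} \<times> {1..n})"
      by (rule indep_vars_compose2) auto
    then show ?thesis by (simp add: Y_def case_prod_beta')
  qed
  \<comment> \<open>The Poisson exponent with its linear term removed; subtracting the mean
    \<open>m i\<close> is what removes it, so the quadratic term leads.\<close>
  define g where "g a n = iexp (a / sqrt (real n)) - 1 - \<i> * of_real (a / sqrt (real n))" for a n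
  have char_Y: "char (distr M borel (Y n (i, j))) s = exp (of_real (m i) * g (s * c i) n)"
    if ij: "i \<in> {1..k}" "j \<ge> 1" for n i j s
  proof -
    define \<theta> where "\<theta> = s * c i / sqrt (real n)"
    have [measurable]: "X i j \<in> measurable M (count_space UNIV)" by (rule X[OF ij])
    have e: "iexp (s * Y n (i, j) \<omega>) = iexp (\<theta> * real (X i j \<omega>)) * iexp (- \<theta> * m i)" for \<omega>
    proof -
      have "s * Y n (i, j) \<omega> = \<theta> * real (X i j \<omega>) + - \<theta> * m i"
        unfolding Y_def \<theta>_def by (simp add: algebra_simps diff_divide_distrib)
      then show ?thesis by (simp only: of_real_add distrib_left exp_add)
    qed
    have "char (distr M borel (Y n (i, j))) s = (CLINT \<omega>|M. iexp (s * Y n (i, j) \<omega>))"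
      unfolding char_def by (subst integral_distr) (auto simp: Y_def)
    also have "\<dots> = (CLINT \<omega>|M. iexp (\<theta> * real (X i j \<omega>)) * iexp (- \<theta> * m i))"
      unfolding e ..
    also have "\<dots> = (CLINT \<omega>|M. iexp (\<theta> * real (X i j \<omega>))) * iexp (- \<theta> * m i)"
      by simp
    also have "(CLINT \<omega>|M. iexp (\<theta> * real (X i j \<omega>)))
        = (CLINT y|distr M (count_space UNIV) (X i j). iexp (\<theta> * real y))"
      by (subst integral_distr) auto
    also have "\<dots> = exp (of_real (m i) * (iexp \<theta> - 1))"
      using char_poisson[OF m[OF ij(1)]] by (simp add: distr[OF ij])
    also have "\<dots> * iexp (- \<theta> * m i) = exp (of_real (m i) * g (s * c i) n)"
    proof -
      have "exp (of_real (m i) * (iexp \<theta> - 1)) * iexp (- \<theta> * m i)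
          = exp (of_real (m i) * (iexp \<theta> - 1) + \<i> * of_real (- \<theta> * m i))" by (rule exp_add[symmetric])
      also have "of_real (m i) * (iexp \<theta> - 1) + \<i> * of_real (- \<theta> * m i) = of_real (m i) * g (s * c i) n"
        unfolding g_def \<theta>_def[symmetric] by (simp add: algebra_simps)
      finally show ?thesis .
    qed
    finally show ?thesis .
  qed
  have char_U: "char (distr M borel (U n)) s = exp (\<Sum>i=1..k. of_real (m i) * (of_nat n * g (s * c i) n))" for n s
  proof -
    have "char (distr M borel (U n)) s = (\<Prod>(i, j)\<in>{1..k} \<times> {1..n}. exp (of_real (m i) * g (s * c i) n))"
      unfolding U_eq char_distr_sum[OF indep_Y] by (intro prod.cong) (auto simp: char_Y)
    also have "\<dots> = (\<Prod>i=1..k. exp (of_real (m i) * (of_nat n * g (s * c i) n)))"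
    proof -
      \<comment> \<open>The factors do not depend on \<open>j\<close>, so the product over the
        \<open>n\<close> rounds is a power.\<close>
      have "exp (of_real (m i) * (of_nat n * g (s * c i) n)) = exp (of_real (m i) * g (s * c i) n) ^ n" for i
        unfolding exp_of_nat_mult[symmetric] by (simp add: mult.left_commute)
      then show ?thesis unfolding prod.cartesian_product[symmetric] by simp
    qed
    finally show ?thesis by (simp add: exp_sum)
  qed
  have "(\<lambda>n. char (distr M borel (U n)) s) \<longlonglongrightarrow> of_real (exp (- (\<Sum>i=1..k. (c i)\<^sup>2 * m i) * s\<^sup>2 / 2))" for s
  proof -
    have "(\<lambda>n. char (distr M borel (U n)) s) \<longlonglongrightarrow> exp (\<Sum>i=1..k. of_real (m i) * of_real (- (s * c i)\<^sup>2 / 2))"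
      unfolding char_U g_def by (intro tendsto_intros tendsto_poisson_exponent)
    also have "(\<Sum>i=1..k. complex_of_real (m i) * of_real (- (s * c i)\<^sup>2 / 2))
        = of_real (- (\<Sum>i=1..k. (c i)\<^sup>2 * m i) * s\<^sup>2 / 2)"
    proof -
      have "(\<Sum>i=1..k. m i * (- (s * c i)\<^sup>2 / 2)) = (\<Sum>i=1..k. - s\<^sup>2 / 2 * ((c i)\<^sup>2 * m i))"
        by (intro sum.cong) (auto simp: power_mult_distrib)
      also have "\<dots> = - (\<Sum>i=1..k. (c i)\<^sup>2 * m i) * s\<^sup>2 / 2"
        unfolding sum_distrib_left[symmetric] by simp
      finally show ?thesis by (simp only: of_real_mult[symmetric] of_real_sum[symmetric])
    qed
    finally show ?thesis by (simp only: exp_of_real)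
  qed
  moreover have "(\<Sum>i=1..k. (c i)\<^sup>2 * m i) \<ge> 0" using m by (intro sum_nonneg) (auto intro!: mult_nonneg_nonneg zero_le_power2 less_imp_le[OF m])
  ultimately show "converges_to_normal M U (\<Sum>i=1..k. (c i)\<^sup>2 * m i)"
    using U by (subst converges_to_normal_iff_char[OF assms(1)]) auto
qed

section \<open>Independence of the counts from another estimator\<close>

text \<open>Measurable images generate smaller sigma-algebras, so they inherit independence. The
  maps \<open>f\<close> and \<open>g\<close> bring variables of different types to the common value
  type of \<open>indep_var\<close>.\<close>

lemma indep_rvs_imp_indep_var:
  assumes "prob_space M" and "indep_rvs M N1 U N2 V"
    and U: "U \<in> measurable M N1" and V: "V \<in> measurable M N2"
    and f: "f \<in> measurable N1 L1" and g: "g \<in> measurable N2 L2"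
  shows "prob_space.indep_var M L1 (\<lambda>\<omega>. f (U \<omega>)) L2 (\<lambda>\<omega>. g (V \<omega>))"
proof -
  interpret prob_space M by fact
  have sub: "sigma_sets (space M) {(\<lambda>\<omega>. h (W \<omega>)) -` A \<inter> space M |A. A \<in> sets L} \<subseteq> sets (vimage_algebra (space M) W N)"
    if W: "W \<in> measurable M N" and h: "h \<in> measurable N L" for W :: "'a \<Rightarrow> 'x" and N L and h :: "'x \<Rightarrow> 'y"
  proof -
    have "W \<in> measurable (vimage_algebra (space M) W N) N"
      using W by (intro measurable_vimage_algebra1) (auto simp: measurable_space)
    then have *: "(\<lambda>\<omega>. h (W \<omega>)) \<in> measurable (vimage_algebra (space M) W N) L"
      using h by (rule measurable_compose)
    have "(\<lambda>\<omega>. h (W \<omega>)) -` A \<inter> space M \<in> sets (vimage_algebra (space M) W N)" if "A \<in> sets L" for A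
      using measurable_sets[OF * that] by simp
    then have "{(\<lambda>\<omega>. h (W \<omega>)) -` A \<inter> space M |A. A \<in> sets L} \<subseteq> sets (vimage_algebra (space M) W N)"
      by blast
    from sets.sigma_sets_subset[OF this] show ?thesis by simp
  qed
  have "indep_set (sets (vimage_algebra (space M) U N1)) (sets (vimage_algebra (space M) V N2))"
    using assms(2) by (simp add: indep_rvs_def)
  then have "indep_set (sigma_sets (space M) {(\<lambda>\<omega>. f (U \<omega>)) -` A \<inter> space M |A. A \<in> sets L1})
     (sigma_sets (space M) {(\<lambda>\<omega>. g (V \<omega>)) -` A \<inter> space M |A. A \<in> sets L2})"
    unfolding indep_set_def
  proof (rule indep_sets_mono_sets)
    fix b :: bool
    show "(case b of True \<Rightarrow> sigma_sets (space M) {(\<lambda>\<omega>. f (U \<omega>)) -` A \<inter> space M |A. A \<in> sets L1}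
        | False \<Rightarrow> sigma_sets (space M) {(\<lambda>\<omega>. g (V \<omega>)) -` A \<inter> space M |A. A \<in> sets L2})
      \<subseteq> (case b of True \<Rightarrow> sets (vimage_algebra (space M) U N1) | False \<Rightarrow> sets (vimage_algebra (space M) V N2))"
      by (cases b) (simp_all only: bool.case sub[OF U f] sub[OF V g])
  qed
  then show ?thesis
    unfolding indep_var_eq using measurable_compose[OF U f] measurable_compose[OF V g] by blast
qed

text \<open>The statistic is a measurable function \<open>?g\<close> of the finite array of counts,
  so independence from the array passes to it.\<close>

lemma indep_var_poisson_array_sum:
  fixes X :: "nat \<Rightarrow> nat \<Rightarrow> 'a \<Rightarrow> nat" and m c :: "nat \<Rightarrow> real" and V :: "'a \<Rightarrow> real"
  assumes "prob_space M"
    and indep: "prob_space.indep_vars M (\<lambda>_. count_space UNIV) (\<lambda>(i, j). X i j) ({1..k} \<times> {1..})"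
    and "V \<in> borel_measurable M" "f \<in> borel_measurable borel"
    and "indep_rvs M borel V (PiM ({1..k} \<times> {1..n}) (\<lambda>_. count_space UNIV))
           (\<lambda>\<omega>. restrict (\<lambda>(i, j). X i j \<omega>) ({1..k} \<times> {1..n}))"
  shows "prob_space.indep_var M borel (\<lambda>\<omega>. f (V \<omega>)) borel
     (\<lambda>\<omega>. (\<Sum>j=1..n. \<Sum>i=1..k. c i * (real (X i j \<omega>) - m i)) / sqrt (real n))"
proof -
  interpret prob_space M by fact
  let ?I = "{1..k} \<times> {1..n}"
  let ?g = "\<lambda>d. (\<Sum>j=1..n. \<Sum>i=1..k. c i * (real (d (i, j)) - m i)) / sqrt (real n)"
  have X: "X i j \<in> measurable M (count_space UNIV)" if "i \<in> {1..k}" "j \<ge> 1" for i j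
    using indep that by (auto simp: indep_vars_def)
  have d: "(\<lambda>\<omega>. restrict (\<lambda>(i, j). X i j \<omega>) ?I) \<in> measurable M (PiM ?I (\<lambda>_. count_space UNIV))"
    by (rule measurable_restrict) (use X in auto)
  have g: "?g \<in> borel_measurable (PiM ?I (\<lambda>_. count_space UNIV))"
    by (intro borel_measurable_divide borel_measurable_sum borel_measurable_times borel_measurable_diff
        measurable_compose[OF measurable_component_singleton] borel_measurable_const) auto
  have "indep_var borel (\<lambda>\<omega>. f (V \<omega>)) borel (\<lambda>\<omega>. ?g (restrict (\<lambda>(i, j). X i j \<omega>) ?I))"
    by (rule indep_rvs_imp_indep_var[OF assms(1,5,3) d assms(4) g])
  moreover have "?g (restrict (\<lambda>(i, j). X i j \<omega>) ?I)
      = (\<Sum>j=1..n. \<Sum>i=1..k. c i * (real (X i j \<omega>) - m i)) / sqrt (real n)" for \<omega>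
    by (intro arg_cong2[where f = "(/)"] sum.cong refl) auto
  ultimately show ?thesis by simp
qed

section \<open>The truncated geometric law and the score equations\<close>

text \<open>This sum and the next two are the moments of order 0, 1 and 2 of \<open>i - 1\<close>
  under geometric weights cut off at \<open>k\<close> terms, before normalisation by
  \<open>1 - x ^ k\<close>.\<close>

lemma sum_geometric_weight: "(\<Sum>i=1..k. (1 - x) * x ^ (i - 1)) = 1 - x ^ k" for x :: real
  by (induction k) (auto simp: algebra_simps)

lemma sum_geometric_weight_index:
  "x \<noteq> 1 \<Longrightarrow> (\<Sum>i=1..k. (real i - 1) * ((1 - x) * x ^ (i - 1))) = x * (1 - x ^ k) / (1 - x) - real k * x ^ k" for x :: real
  by (induction k) (auto simp: field_simps)

lemma sum_geometric_weight_index_square: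
  "x \<noteq> 1 \<Longrightarrow> (\<Sum>i=1..k. (real i - 1)\<^sup>2 * ((1 - x) * x ^ (i - 1)))
    = x * (1 + x) * (1 - x ^ k) / (1 - x)\<^sup>2 - (real k)\<^sup>2 * x ^ k - 2 * real k * x ^ (k + 1) / (1 - x)" for x :: real
proof (induction k)
  case (Suc k)
  then have "x - 1 \<noteq> 0" by simp
  then show ?case
    unfolding sum.nat_ivl_Suc' [of 1 k, simplified] using Suc
    by (simp add: divide_simps) (simp add: algebra_simps power2_eq_square)
qed simp

definition trunc_mean :: "nat \<Rightarrow> real \<Rightarrow> real" where
  "trunc_mean k y = y / (1 - y) - real k * y ^ k / (1 - y ^ k)"

text \<open>For \<open>0 < y < 1\<close> and \<open>k > 1\<close> this is \<open>1 / y\<close> times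
  the variance of the truncated law (see \<open>trunc_variance\<close>), written as a difference of
  two squares.\<close>

definition trunc_mean_deriv :: "nat \<Rightarrow> real \<Rightarrow> real" where
  "trunc_mean_deriv k y = 1 / (1 - y)\<^sup>2 - (real k)\<^sup>2 * y ^ (k - 1) / (1 - y ^ k)\<^sup>2"

lemma power_less_one: "0 < y \<Longrightarrow> y < 1 \<Longrightarrow> k > 1 \<Longrightarrow> y ^ k < 1" for y :: real
  by (simp add: power_less_one_iff)

lemma DERIV_trunc_mean:
  assumes "0 < y" "y < 1" "k > 1"
  shows "(trunc_mean k has_real_derivative trunc_mean_deriv k y) (at y)"
proof -
  have ne: "1 - y \<noteq> 0" "1 - y ^ k \<noteq> 0" using assms power_less_one[OF assms] by auto
  have p: "y ^ k = y * y ^ (k - 1)" using assms by (metis One_nat_def less_trans power_eq_if zero_less_one not_less_zero)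
  show ?thesis unfolding trunc_mean_def[abs_def] trunc_mean_deriv_def
    apply (rule derivative_eq_intros refl ne)+
    using ne by (simp add: field_simps power2_eq_square p)
qed

lemma trunc_mean_deriv_pos:
  assumes "0 < y" "y < 1" "k > 1"
  shows "trunc_mean_deriv k y > 0"
proof -
  \<comment> \<open>AM-GM on the pairs \<open>y\<^sup>i\<close>, \<open>y\<^bsup>k-1-i\<^esup>\<close> bounds the geometric sum below by \<open>k\<close> times \<open>s\<close>.\<close>
  define s where "s = sqrt (y ^ (k - 1))"
  have s: "s > 0" "s\<^sup>2 = y ^ (k - 1)" using assms by (auto simp: s_def)
  have pair: "2 * s \<le> y ^ i + y ^ (k - 1 - i)" if "i < k" for i
  proof -
    have "y ^ i * y ^ (k - 1 - i) = y ^ (k - 1)" using that by (simp add: power_add[symmetric])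
    then show ?thesis using arith_geo_mean_sqrt[of "y ^ i" "y ^ (k - 1 - i)"] assms by (simp add: s_def)
  qed
  have "y ^ (k - 1) < 1" using assms by (simp add: power_less_one_iff)
  then have "s \<noteq> 1" using s by auto
  then have "(1 - s)\<^sup>2 > 0" by simp
  \<comment> \<open>The pair \<open>i = 0\<close> consists of 1 and \<open>s^2\<close>, so its AM-GM
    inequality is strict; this one pair makes the summed inequality strict.\<close>
  then have pair0: "2 * s < y ^ 0 + y ^ (k - 1 - 0)" using s by (simp add: power2_eq_square algebra_simps)
  have "real k * (2 * s) = (\<Sum>i<k. 2 * s)" by simp
  also have "\<dots> < (\<Sum>i<k. y ^ i + y ^ (k - 1 - i))"
    using pair pair0 assms by (intro sum_strict_mono_ex1) (auto intro!: bexI[of _ 0])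
  also have "\<dots> = (\<Sum>i<k. y ^ i) + (\<Sum>i<k. y ^ (k - 1 - i))" by (rule sum.distrib)
  also have "(\<Sum>i<k. y ^ (k - 1 - i)) = (\<Sum>i<k. y ^ i)"
    using sum.nat_diff_reindex[of "\<lambda>i. y ^ i" k] by simp
  finally have "real k * s < (\<Sum>i<k. y ^ i)" by simp
  then have "real k * s * (1 - y) < (\<Sum>i<k. y ^ i) * (1 - y)" using assms by simp
  also have "\<dots> = 1 - y ^ k" by (simp add: one_diff_power_eq mult.commute)
  finally have l: "real k * s * (1 - y) < 1 - y ^ k" .
  have pos: "1 - y > 0" "1 - y ^ k > 0" using assms power_less_one[OF assms] by auto
  \<comment> \<open>The two sides are the square roots of the two terms of
    \<open>trunc_mean_deriv k y\<close>.\<close>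
  have "real k * s / (1 - y ^ k) < 1 / (1 - y)" using l pos by (simp add: field_simps)
  then have "(real k * s / (1 - y ^ k))\<^sup>2 < (1 / (1 - y))\<^sup>2"
    using s pos by (intro power_strict_mono) auto
  then show ?thesis by (simp add: trunc_mean_deriv_def power_divide power_mult_distrib s)
qed

lemma trunc_mean_strict_mono:
  assumes "0 < y" "y < y'" "y' < 1" "k > 1"
  shows "trunc_mean k y < trunc_mean k y'"
proof (rule DERIV_pos_imp_increasing[OF assms(2)])
  fix z assume "y \<le> z" "z \<le> y'"
  then show "\<exists>d. (trunc_mean k has_real_derivative d) (at z) \<and> 0 < d"
    using assms DERIV_trunc_mean[of z k] trunc_mean_deriv_pos[of z k] by auto
qed

text \<open>Links the polynomial in the stated variance to the derivative: with
  \<open>x = 1 - p\<close> it is \<open>(1 - x^k)^2 - k^2 x^(k-1) (1 - x)^2\<close>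
  expanded.\<close>

lemma q_poly_eq:
  assumes "0 < p" "p < 1" "k > 1"
  shows "q_poly p k = p\<^sup>2 * (1 - (1 - p) ^ k)\<^sup>2 * trunc_mean_deriv k (1 - p)"
proof -
  have ne: "1 - (1 - p) ^ k \<noteq> 0" using assms power_less_one[of "1 - p" k] by auto
  \<comment> \<open>Writing \<open>k\<close> as a successor removes the truncated subtraction in the
    exponent \<open>k - 1\<close>.\<close>
  obtain j where j: "k = Suc j" using assms by (cases k) auto
  have "p\<^sup>2 * (1 - (1 - p) ^ k)\<^sup>2 * trunc_mean_deriv k (1 - p)
     = (1 - (1 - p) ^ k)\<^sup>2 - (real k)\<^sup>2 * (1 - p) ^ (k - 1) * p\<^sup>2"
    using ne assms by (simp add: trunc_mean_deriv_def field_simps)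
  also have "\<dots> = q_poly p k"
    unfolding q_poly_def j by (simp add: power2_eq_square algebra_simps power_mult power_add)
  finally show ?thesis by simp
qed

text \<open>The first identity centres the coefficients \<open>i - 1 - r\<close> of the linear
  statistic in the numerator of \<open>z / s - r\<close>; the second supplies its limiting variance.
  Both follow from the three geometric moments.\<close>

lemma trunc_variance:
  assumes "0 < x" "x < 1" "k > 1"
  defines "r \<equiv> trunc_mean k x"
  shows "(\<Sum>i=1..k. (real i - 1 - r) * ((1 - x) * x ^ (i - 1))) = 0"
    and "(\<Sum>i=1..k. (real i - 1 - r)\<^sup>2 * ((1 - x) * x ^ (i - 1))) = (1 - x ^ k) * x * trunc_mean_deriv k x"
proof -
  have ne: "1 - x \<noteq> 0" "1 - x ^ k \<noteq> 0" "x \<noteq> 1" using assms power_less_one[of x k] by auto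
  let ?w = "\<lambda>i. (1 - x) * x ^ (i - 1)"
  have s1: "(\<Sum>i=1..k. (real i - 1) * ?w i) = r * (1 - x ^ k)"
    using ne by (subst sum_geometric_weight_index) (simp_all add: r_def trunc_mean_def left_diff_distrib)
  show "(\<Sum>i=1..k. (real i - 1 - r) * ?w i) = 0"
    unfolding left_diff_distrib[of "_ - 1" r] sum_subtractf sum_distrib_left[where r = r, symmetric]
      sum_geometric_weight s1 by simp
  have p: "x * x ^ (k - 1) = x ^ k" using assms by (cases k) auto
  have "(\<Sum>i=1..k. (real i - 1 - r)\<^sup>2 * ?w i) = (\<Sum>i=1..k. (real i - 1)\<^sup>2 * ?w i - 2 * r * ((real i - 1) * ?w i) + r\<^sup>2 * ?w i)"
    by (intro sum.cong) (auto simp: power2_eq_square algebra_simps)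
  also have "\<dots> = (\<Sum>i=1..k. (real i - 1)\<^sup>2 * ?w i) - r\<^sup>2 * (1 - x ^ k)"
    unfolding sum_subtractf sum.distrib sum_distrib_left[where r = "2 * r", symmetric]
      sum_distrib_left[where r = "r\<^sup>2", symmetric] s1 sum_geometric_weight by (simp add: power2_eq_square)
  also have "\<dots> = (1 - x ^ k) * (x / (1 - x)\<^sup>2) - (1 - x ^ k) * ((real k)\<^sup>2 * x ^ k / (1 - x ^ k)\<^sup>2)"
  proof -
    \<comment> \<open>\<open>A\<close> and \<open>B\<close> stand for \<open>1 - x\<close> and
      \<open>1 - x ^ k\<close>. Treating them and \<open>k\<close> as free reals leaves a rational
      identity.\<close>
    have "x * (1 + x) * B / A\<^sup>2 - K\<^sup>2 * y - 2 * K * (x * y) / A - (x / A - K * y / B)\<^sup>2 * B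
        = B * (x / A\<^sup>2) - B * (K\<^sup>2 * y / B\<^sup>2)"
      if "A \<noteq> 0" "B \<noteq> 0" "x = 1 - A" "y = 1 - B" for A B K y :: real
      using that(1,2) unfolding that(3,4) by (simp add: divide_simps power2_eq_square) (simp add: algebra_simps)
    from this[of "1 - x" "1 - x ^ k" "x ^ k" "real k"] show ?thesis
      using ne by (subst sum_geometric_weight_index_square) (simp_all add: r_def trunc_mean_def)
  qed
  also have "\<dots> = (1 - x ^ k) * x * trunc_mean_deriv k x"
    by (simp add: trunc_mean_deriv_def p[symmetric] algebra_simps)
  finally show "(\<Sum>i=1..k. (real i - 1 - r)\<^sup>2 * ?w i) = (1 - x ^ k) * x * trunc_mean_deriv k x" .
qed

section \<open>Roots of the score equations\<close>

text \<open>The first equation determines \<open>l\<close> from \<open>p\<close>; inserting it into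
  the second eliminates \<open>l\<close>. Positivity of \<open>l\<close> is then the same as
  positivity of \<open>s\<close>.\<close>

lemma solves_score_iff:
  assumes "k > 1" "t > 0" "0 < p" "p < 1"
  shows "solves_score k t s z p l \<longleftrightarrow>
    s > 0 \<and> z = s * trunc_mean k (1 - p) \<and> l = s / (t * (1 - (1 - p) ^ k))"
proof -
  define x where "x = 1 - p"
  have x: "0 < x" "x < 1" "x ^ k < 1" using assms power_less_one[of x k] by (auto simp: x_def)
  have p: "p = 1 - x" by (simp add: x_def)
  have "s - l * t * (1 - x ^ k) = 0 \<longleftrightarrow> l = s / (t * (1 - x ^ k))"
    using x assms by (auto simp: field_simps)
  moreover have "t * (1 - x ^ k) > 0" using x assms by simp
  then have "l > 0 \<longleftrightarrow> s > 0" if "l = s / (t * (1 - x ^ k))"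
    using that by (auto simp: zero_less_divide_iff)
  moreover have "x * (s + z) - z - l * t * (real k * x ^ k - real k * x ^ (k + 1)) = 0 \<longleftrightarrow> z = s * trunc_mean k x"
    if "l = s / (t * (1 - x ^ k))"
  proof -
    have lt: "l * t = s / (1 - x ^ k)" unfolding that using assms by simp
    have e: "z = s * trunc_mean k x \<longleftrightarrow> (1 - x) * z = (1 - x) * (s * trunc_mean k x)" using x by simp
    have f: "(1 - x) * (s * trunc_mean k x) = x * s - s / (1 - x ^ k) * (real k * x ^ k - real k * x ^ (k + 1))"
    proof -
      have "(1 - x) * (s * (x / (1 - x) - c / B)) = x * s - s / B * (c * (1 - x))" for c B
        using x by (cases "B = 0") (simp_all add: field_simps)
      moreover have "real k * x ^ k * (1 - x) = real k * x ^ k - real k * x ^ (k + 1)"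
        by (simp add: algebra_simps)
      ultimately show ?thesis unfolding trunc_mean_def by simp
    qed
    show ?thesis unfolding e f lt by (auto simp: algebra_simps)
  qed
  ultimately show ?thesis
    unfolding solves_score_def x_def[symmetric] using assms x by (auto simp: p)
qed

text \<open>Existence is the intermediate value theorem; localisation of every solution is strict
  monotonicity. Existence triggers the implication in \<open>is_mle\<close>, after which the
  location applies to the estimator.\<close>

lemma score_root_near:
  assumes "k > 1" "t > 0" "0 < a" "a < b" "b < 1" "s > 0"
    and "trunc_mean k a < z / s" "z / s < trunc_mean k b"
  shows "\<exists>p l. solves_score k t s z p l"
    and "solves_score k t s z p l \<Longrightarrow> a < 1 - p \<and> 1 - p < b \<and> trunc_mean k (1 - p) = z / s"
proof -
  have "\<exists>y\<ge>a. y \<le> b \<and> trunc_mean k y = z / s"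
  proof (rule IVT)
    show "\<forall>y. a \<le> y \<and> y \<le> b \<longrightarrow> isCont (trunc_mean k) y"
      using assms by (auto intro!: DERIV_isCont DERIV_trunc_mean)
  qed (use assms in auto)
  then obtain y where y: "a \<le> y" "y \<le> b" "trunc_mean k y = z / s" by blast
  have "solves_score k t s z (1 - y) (s / (t * (1 - y ^ k)))"
    using y assms by (subst solves_score_iff) auto
  then show "\<exists>p l. solves_score k t s z p l" by blast
  assume sol: "solves_score k t s z p l"
  then have p: "0 < p" "p < 1" by (auto simp: solves_score_def order_less_le)
  from sol have e: "trunc_mean k (1 - p) = z / s"
    unfolding solves_score_iff[OF assms(1,2) p] by auto
  have "\<not> 1 - p \<le> a" using trunc_mean_strict_mono[of "1 - p" a k] e assms p by (cases "1 - p = a") auto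
  moreover have "\<not> b \<le> 1 - p" using trunc_mean_strict_mono[of b "1 - p" k] e assms p by (cases "1 - p = b") auto
  ultimately show "a < 1 - p \<and> 1 - p < b \<and> trunc_mean k (1 - p) = z / s" using e by simp
qed

section \<open>Expansion of the estimators\<close>

text \<open>Dividing by \<open>sqrt n\<close> twice exposes a normalised sum over a root, to which
  \<open>converges_to_normal_div_sqrt_vanishes\<close> applies. The coefficient 1 matches the shape
  of \<open>poisson_array_clt\<close>.\<close>

lemma s_stat_eq:
  assumes "n \<ge> 1"
  shows "s_stat k X n \<omega> = (\<Sum>i=1..k. m i)
     + (\<Sum>j=1..n. \<Sum>i=1..k. 1 * (real (X i j \<omega>) - m i)) / sqrt (real n) / sqrt (real n)"
  using assms by (simp add: s_stat_def sum_subtractf real_div_sqrt field_simps)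

text \<open>Since the weights \<open>i - 1 - r\<close> annihilate the means \<open>m i\<close>,
  subtracting those means changes nothing.\<close>

lemma z_stat_eq:
  assumes "n \<ge> 1" "(\<Sum>i=1..k. (real i - 1 - r) * m i) = 0"
  shows "z_stat k X n \<omega> - r * s_stat k X n \<omega>
     = (\<Sum>j=1..n. \<Sum>i=1..k. (real i - 1 - r) * (real (X i j \<omega>) - m i)) / sqrt (real n) / sqrt (real n)"
proof -
  have "(\<Sum>j=1..n. \<Sum>i=1..k. (real i - 1 - r) * (real (X i j \<omega>) - m i))
      = (\<Sum>j=1..n. \<Sum>i=1..k. (real i - 1 - r) * real (X i j \<omega>))"
    using assms(2) by (simp add: right_diff_distrib sum_subtractf)
  also have "\<dots> = (\<Sum>j=1..n. \<Sum>i=1..k. (real i - 1) * real (X i j \<omega>)) - r * (\<Sum>j=1..n. \<Sum>i=1..k. real (X i j \<omega>))"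
    by (simp add: left_diff_distrib sum_subtractf sum_distrib_left)
  finally show ?thesis using assms(1)
    by (simp add: s_stat_def z_stat_def diff_divide_distrib)
qed

text \<open>The limit \<open>- (1 / (E * D))\<close> combines \<open>s_stat\<close>, which tends to
  \<open>E\<close>, with the slope \<open>D\<close> of \<open>trunc_mean\<close>; the sign arises
  because the root is \<open>1 - p\<close> and not \<open>p\<close>.\<close>

lemma mle_expansion:
  fixes X :: "nat \<Rightarrow> nat \<Rightarrow> 'a \<Rightarrow> nat"
  assumes M: "prob_space M"
    and par: "k > 1" "t > 0" "0 < p" "p < 1" "0 < lam"
    and indep: "prob_space.indep_vars M (\<lambda>_. count_space UNIV) (\<lambda>(i, j). X i j) ({1..k} \<times> {1..})"
    and distr: "\<And>i j. i \<in> {1..k} \<Longrightarrow> j \<ge> 1 \<Longrightarrow>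
           distr M (count_space UNIV) (X i j)
             = measure_pmf (poisson_pmf (p * (1 - p) ^ (i - 1) * lam * t))"
    and mle: "\<And>n. n \<ge> 1 \<Longrightarrow> is_mle M k t X n (p_hat n) (lam_hat n)"
    and m_def: "m = (\<lambda>i. p * (1 - p) ^ (i - 1) * lam * t)"
    and r_def: "r = trunc_mean k (1 - p)" and D_def: "D = trunc_mean_deriv k (1 - p)"
    and E_def: "E = lam * t * (1 - (1 - p) ^ k)"
    and W_def: "W = (\<lambda>n \<omega>. (\<Sum>j=1..n. \<Sum>i=1..k.
      (real i - 1 - r) * (real (X i j \<omega>) - m i)) / sqrt (real n))"
  shows "converges_to_normal M W (E * (1 - p) * D)"
    and "W n \<in> borel_measurable M"
    and "((\<lambda>(n, \<omega>). p_hat n \<omega>) \<longlongrightarrow> p) (whp M)"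
    and "\<exists>a. ((\<lambda>(n, \<omega>). a n \<omega>) \<longlongrightarrow> - (1 / (E * D))) (whp M) \<and>
       (\<forall>\<^sub>F (n, \<omega>) in whp M. sqrt (real n) * (p_hat n \<omega> - p) = a n \<omega> * W n \<omega>)"
proof -
  interpret prob_space M by fact
  define x where "x = 1 - p"
  have x: "0 < x" "x < 1" "x ^ k < 1" and p: "p = 1 - x" using par power_less_one[of x k] by (auto simp: x_def)
  have m_pos: "m i > 0" for i using par by (simp add: m_def)
  have m_eq: "m i = lam * t * ((1 - x) * x ^ (i - 1))" for i by (simp add: m_def p)
  have E: "E > 0" using par x by (simp add: E_def x_def)
  have D: "D > 0" using trunc_mean_deriv_pos[OF x(1,2) par(1)] by (simp add: D_def x_def)
  have distr': "distr M (count_space UNIV) (X i j) = measure_pmf (poisson_pmf (m i))"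
    if "i \<in> {1..k}" "j \<ge> 1" for i j using distr[OF that] by (simp add: m_def)
  have swap: "(\<Sum>i=1..k. f i * m i) = lam * t * (\<Sum>i=1..k. f i * ((1 - x) * x ^ (i - 1)))" for f :: "nat \<Rightarrow> real"
    unfolding m_eq sum_distrib_left by (intro sum.cong) (auto simp: mult_ac)
  have sum_m: "(\<Sum>i=1..k. m i) = E"
    using swap[of "\<lambda>_. 1"] sum_geometric_weight[of x k] by (simp add: E_def x_def)
  have mean0: "(\<Sum>i=1..k. (real i - 1 - r) * m i) = 0"
    unfolding swap r_def x_def[symmetric] trunc_variance(1)[OF x(1,2) par(1)] by simp
  have var: "(\<Sum>i=1..k. (real i - 1 - r)\<^sup>2 * m i) = E * (1 - p) * D"
    unfolding swap r_def x_def[symmetric] trunc_variance(2)[OF x(1,2) par(1)]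
    by (simp add: E_def D_def x_def)
  show W: "converges_to_normal M W (E * (1 - p) * D)" and Wm: "W n \<in> borel_measurable M" for n
    unfolding var[symmetric] W_def by (rule poisson_array_clt[OF M indep distr' m_pos]; simp)+
  have vW: "E * (1 - p) * D \<ge> 0" using E D par by simp
  define S where "S = (\<lambda>n \<omega>. (\<Sum>j=1..n. \<Sum>i=1..k. 1 * (real (X i j \<omega>) - m i)) / sqrt (real n))"
  have S: "converges_to_normal M S E" "S n \<in> borel_measurable M" for n
  proof -
    have "E = (\<Sum>i=1..k. 1\<^sup>2 * m i)" unfolding sum_m[symmetric] by simp
    then show "converges_to_normal M S E"
      unfolding S_def by (simp only:) (rule poisson_array_clt(1)[OF M indep distr' m_pos]; simp)
    show "S n \<in> borel_measurable M"
      unfolding S_def by (rule poisson_array_clt(2)[OF M indep distr' m_pos]; simp)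
  qed
  let ?s = "\<lambda>n \<omega>. s_stat k X n \<omega>" and ?z = "\<lambda>n \<omega>. z_stat k X n \<omega>"
  note idx = filterlim_ident[of sequentially]
  have "((\<lambda>x. E + (\<lambda>(n, \<omega>). S n \<omega> / sqrt (real n)) x) \<longlongrightarrow> E + 0) (whp M)"
    using converges_to_normal_div_sqrt_vanishes[OF M less_imp_le[OF E] S(2,1) idx]
    by (intro tendsto_add tendsto_const)
  then have "((\<lambda>x. E + (\<lambda>(n, \<omega>). S n \<omega> / sqrt (real n)) x) \<longlongrightarrow> E) (whp M)" by simp
  then have s_lim: "((\<lambda>(n, \<omega>). ?s n \<omega>) \<longlongrightarrow> E) (whp M)"
    by (rule Lim_transform_eventually)
       (use eventually_whp_index[OF M, of 1] in \<open>auto simp: s_stat_eq[where m = m and k = k, unfolded sum_m] S_def elim!: eventually_mono\<close>)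
  have s_pos: "\<forall>\<^sub>F (n, \<omega>) in whp M. ?s n \<omega> > 0"
    using order_tendstoD(1)[OF s_lim E] by (simp add: case_prod_beta')
  have ratio: "\<forall>\<^sub>F (n, \<omega>) in whp M. ?z n \<omega> / ?s n \<omega> = r + W n \<omega> / sqrt (real n) / ?s n \<omega>"
    using eventually_whp_index[OF M, of 1] s_pos
  proof eventually_elim
    case (elim y)
    then show ?case
      using z_stat_eq[OF _ mean0, of "fst y" X "snd y"] by (auto simp: W_def field_simps)
  qed
  have "((\<lambda>x. r + (\<lambda>(n, \<omega>). W n \<omega> / sqrt (real n)) x / (\<lambda>(n, \<omega>). ?s n \<omega>) x) \<longlongrightarrow> r + 0 / E) (whp M)"
    using converges_to_normal_div_sqrt_vanishes[OF M vW Wm W idx] s_lim E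
    by (intro tendsto_add tendsto_const tendsto_divide) auto
  then have "((\<lambda>x. r + (\<lambda>(n, \<omega>). W n \<omega> / sqrt (real n)) x / (\<lambda>(n, \<omega>). ?s n \<omega>) x) \<longlongrightarrow> r) (whp M)" by simp
  then have r_lim: "((\<lambda>(n, \<omega>). ?z n \<omega> / ?s n \<omega>) \<longlongrightarrow> r) (whp M)"
    by (rule Lim_transform_eventually) (use ratio in \<open>auto elim!: eventually_mono\<close>)
  \<comment> \<open>With high probability \<open>z / s\<close> falls between the values of
    \<open>trunc_mean\<close> at \<open>a\<close> and \<open>b\<close>; there a solution exists, so
    \<open>p_hat\<close> is a genuine root lying in the bracket.\<close>
  have near: "\<forall>\<^sub>F (n, \<omega>) in whp M. a < 1 - p_hat n \<omega> \<and> 1 - p_hat n \<omega> < b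
      \<and> trunc_mean k (1 - p_hat n \<omega>) = ?z n \<omega> / ?s n \<omega>"
    if ab: "0 < a" "a < x" "x < b" "b < 1" for a b
  proof -
    have "trunc_mean k a < r" "r < trunc_mean k b"
      using ab x par by (auto simp: r_def x_def[symmetric] intro!: trunc_mean_strict_mono)
    with order_tendstoD[OF r_lim]
    have "\<forall>\<^sub>F y in whp M. trunc_mean k a < (\<lambda>(n, \<omega>). ?z n \<omega> / ?s n \<omega>) y"
      "\<forall>\<^sub>F y in whp M. (\<lambda>(n, \<omega>). ?z n \<omega> / ?s n \<omega>) y < trunc_mean k b" by blast+
    then show ?thesis using eventually_whp_index[OF M, of 1] s_pos
    proof eventually_elim
      case (elim y)
      obtain n \<omega> where y: "y = (n, \<omega>)" by (cases y)
      have e: "?s n \<omega> > 0" "trunc_mean k a < ?z n \<omega> / ?s n \<omega>" "?z n \<omega> / ?s n \<omega> < trunc_mean k b"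
        and n: "n \<ge> 1" "\<omega> \<in> space M" using elim by (auto simp: y)
      have "a < b" using ab by simp
      note root = score_root_near[OF par(1,2) ab(1) \<open>a < b\<close> ab(4) e]
      have "solves_score k t (?s n \<omega>) (?z n \<omega>) (p_hat n \<omega>) (lam_hat n \<omega>)"
        using mle[OF n(1)] root(1) n(2) unfolding is_mle_def by blast
      from root(2)[OF this] show ?case by (simp add: y)
    qed
  qed
  show p_lim: "((\<lambda>(n, \<omega>). p_hat n \<omega>) \<longlongrightarrow> p) (whp M)"
  proof (rule tendstoI)
    fix e :: real assume "e > 0"
    \<comment> \<open>The bounds \<open>x / 2\<close> and \<open>(1 + x) / 2\<close> keep the
      bracket inside the open unit interval when \<open>e\<close> is large.\<close>
    then have "\<forall>\<^sub>F (n, \<omega>) in whp M. max (x - e) (x / 2) < 1 - p_hat n \<omega> \<and> 1 - p_hat n \<omega> < min (x + e) ((1 + x) / 2)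
      \<and> trunc_mean k (1 - p_hat n \<omega>) = ?z n \<omega> / ?s n \<omega>"
      using x by (intro near) (auto simp: min_less_iff_disj less_max_iff_disj)
    then show "\<forall>\<^sub>F y in whp M. dist (case y of (n, \<omega>) \<Rightarrow> p_hat n \<omega>) p < e"
      by eventually_elim (auto simp: dist_real_def p abs_less_iff)
  qed
  have root_eq: "\<forall>\<^sub>F (n, \<omega>) in whp M. trunc_mean k (1 - p_hat n \<omega>) = ?z n \<omega> / ?s n \<omega>"
    using near[of "x / 2" "(1 + x) / 2"] x by (auto elim!: eventually_mono)
  \<comment> \<open>Caratheodory's form of the derivative: an exact difference quotient, continuous
    at \<open>x\<close>, so there is no remainder term to estimate.\<close>
  obtain g where g: "\<And>y. trunc_mean k y - trunc_mean k x = g y * (y - x)" "isCont g x" "g x = D"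
    using DERIV_trunc_mean[OF x(1,2) par(1)] unfolding CARAT_DERIV D_def x_def[symmetric] by blast
  have "((\<lambda>y. 1 - (\<lambda>(n, \<omega>). p_hat n \<omega>) y) \<longlongrightarrow> x) (whp M)"
    unfolding x_def by (intro tendsto_intros p_lim)
  from isCont_tendsto_compose[OF g(2) this]
  have "((\<lambda>y. g (1 - (\<lambda>(n, \<omega>). p_hat n \<omega>) y)) \<longlongrightarrow> D) (whp M)" by (simp add: g(3))
  then have g_lim: "((\<lambda>(n, \<omega>). g (1 - p_hat n \<omega>)) \<longlongrightarrow> D) (whp M)" by (simp add: case_prod_beta')
  have g_pos: "\<forall>\<^sub>F (n, \<omega>) in whp M. g (1 - p_hat n \<omega>) > 0"
    using order_tendstoD(1)[OF g_lim D] by (simp add: case_prod_beta')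
  let ?a = "\<lambda>n \<omega>. - (1 / (?s n \<omega> * g (1 - p_hat n \<omega>)))"
  have "((\<lambda>y. - (1 / ((\<lambda>(n, \<omega>). ?s n \<omega>) y * (\<lambda>(n, \<omega>). g (1 - p_hat n \<omega>)) y))) \<longlongrightarrow> - (1 / (E * D))) (whp M)"
    using E D by (intro tendsto_intros s_lim g_lim) auto
  then have "((\<lambda>(n, \<omega>). ?a n \<omega>) \<longlongrightarrow> - (1 / (E * D))) (whp M)"
    by (simp add: case_prod_beta')
  moreover have "\<forall>\<^sub>F (n, \<omega>) in whp M. sqrt (real n) * (p_hat n \<omega> - p) = ?a n \<omega> * W n \<omega>"
    using eventually_whp_index[OF M, of 1] s_pos g_pos ratio root_eq
  proof eventually_elim
    case (elim y)
    obtain n \<omega> where y: "y = (n, \<omega>)" by (cases y)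
    have h: "n \<ge> 1" "?s n \<omega> > 0" "g (1 - p_hat n \<omega>) > 0"
      "?z n \<omega> / ?s n \<omega> = r + W n \<omega> / sqrt (real n) / ?s n \<omega>"
      "trunc_mean k (1 - p_hat n \<omega>) = ?z n \<omega> / ?s n \<omega>" using elim by (auto simp: y)
    have "g (1 - p_hat n \<omega>) * (p - p_hat n \<omega>) = W n \<omega> / sqrt (real n) / ?s n \<omega>"
      using g(1)[of "1 - p_hat n \<omega>"] h(4,5) by (simp add: r_def x_def)
    then have "sqrt (real n) * (p - p_hat n \<omega>) = W n \<omega> / (?s n \<omega> * g (1 - p_hat n \<omega>))"
      using h(1-3) by (simp add: field_simps)
    then show ?case by (simp add: y algebra_simps)
  qed
  ultimately show "\<exists>a. ((\<lambda>(n, \<omega>). a n \<omega>) \<longlongrightarrow> - (1 / (E * D))) (whp M) \<and>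
       (\<forall>\<^sub>F (n, \<omega>) in whp M. sqrt (real n) * (p_hat n \<omega> - p) = a n \<omega> * W n \<omega>)"
    by blast
qed

text \<open>Rounding up moves \<open>\<gamma> * n\<close> by at most 1, so \<open>N n / n\<close>
  tends to \<open>\<gamma>\<close>. The second limit later contributes the factor
  \<open>1 / \<gamma>\<close> of the variance.\<close>

lemma ceiling_index_asymptotics:
  fixes \<gamma> :: real
  assumes "\<gamma> > 0" and N_def: "N = (\<lambda>n. nat \<lceil>\<gamma> * real n\<rceil>)"
  shows "filterlim N at_top sequentially"
    and "(\<lambda>n. sqrt (real n) / sqrt (real (N n))) \<longlonglongrightarrow> 1 / sqrt \<gamma>"
proof -
  have N: "\<gamma> * real n \<le> real (N n)" "real (N n) \<le> \<gamma> * real n + 1" for n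
    using assms by (auto simp: N_def of_nat_nat intro: order_trans[of _ 0])
  have "filterlim (\<lambda>n. real (N n)) at_top sequentially"
  proof (rule filterlim_at_top_mono)
    show "filterlim (\<lambda>n. \<gamma> * real n) at_top sequentially"
      using assms by real_asymp
  qed (use N in auto)
  then show "filterlim N at_top sequentially"
    by (subst filterlim_sequentially_iff_filterlim_real)
  have "(\<lambda>n. real (N n) / real n) \<longlonglongrightarrow> \<gamma>"
  proof (rule tendsto_sandwich)
    show "\<forall>\<^sub>F n in sequentially. \<gamma> \<le> real (N n) / real n"
      using eventually_gt_at_top[of 0] by eventually_elim (use N in \<open>auto simp: field_simps\<close>)
    show "\<forall>\<^sub>F n in sequentially. real (N n) / real n \<le> \<gamma> + 1 / real n"
      using eventually_gt_at_top[of 0] by eventually_elim (use N in \<open>auto simp: field_simps\<close>)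
    show "(\<lambda>n. \<gamma> + 1 / real n) \<longlonglongrightarrow> \<gamma>" by real_asymp
  qed auto
  then have "(\<lambda>n. 1 / sqrt (real (N n) / real n)) \<longlonglongrightarrow> 1 / sqrt \<gamma>"
    using assms by (intro tendsto_intros) auto
  then show "(\<lambda>n. sqrt (real n) / sqrt (real (N n))) \<longlonglongrightarrow> 1 / sqrt \<gamma>"
    by (simp add: real_sqrt_divide)
qed

text \<open>The parameters are interior and \<open>chi\<close> is nonzero, so no quotient in the
  variances is a default value of division by zero. Independence of \<open>chi_hat\<close> from the
  counts is why the two variance contributions add without a covariance.\<close>

theorem corollary1:
  fixes M :: "'a measure"
    and k :: nat
    and t p lam chi sigma_chi \<gamma> :: real
    and X :: "nat \<Rightarrow> nat \<Rightarrow> 'a \<Rightarrow> nat"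
    and p_hat lam_hat chi_hat :: "nat \<Rightarrow> 'a \<Rightarrow> real"
  assumes "prob_space M"
    and "k > 1" and "t > 0" and "0 < p" "p < 1" and "0 < lam"
    and "chi \<noteq> 0" and "\<gamma> > 0"
    and "prob_space.indep_vars M (\<lambda>_. count_space UNIV) (\<lambda>(i, j). X i j) ({1..k} \<times> {1..})"
    and "\<And>i j. i \<in> {1..k} \<Longrightarrow> j \<ge> 1 \<Longrightarrow>
           distr M (count_space UNIV) (X i j)
             = measure_pmf (poisson_pmf (p * (1 - p) ^ (i - 1) * lam * t))"
    and "\<And>n. n \<ge> 1 \<Longrightarrow> is_mle M k t X n (p_hat n) (lam_hat n)"
    and "\<And>m. chi_hat m \<in> borel_measurable M"
    and "\<And>m n. indep_rvs M borel (chi_hat m)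
           (PiM ({1..k} \<times> {1..n}) (\<lambda>_. count_space UNIV))
           (\<lambda>\<omega>. restrict (\<lambda>(i, j). X i j \<omega>) ({1..k} \<times> {1..n}))"
    and "converges_to_normal M (\<lambda>m \<omega>. sqrt (real m) * (chi_hat m \<omega> - chi)) (sigma_chi\<^sup>2)"
  shows "converges_to_normal M (\<lambda>n \<omega>. sqrt (real n) * (p_hat n \<omega> - p)) (var_p k t p lam) \<and>
         converges_to_normal M
           (\<lambda>n \<omega>. sqrt (real n) *
              (wavelength (p_hat n \<omega>) (chi_hat (nat \<lceil>\<gamma> * real n\<rceil>) \<omega>) - wavelength p chi))
           (var_wavelength k t p lam chi (sigma_chi\<^sup>2) \<gamma>)"
proof -
  note M = assms(1) and par = assms(2-6) and chi = assms(7) and \<gamma> = assms(8)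
  note chi_meas[measurable] = assms(12)
  interpret prob_space M by fact
  define m where "m = (\<lambda>i::nat. p * (1 - p) ^ (i - 1) * lam * t)"
  define r where "r = trunc_mean k (1 - p)"
  define D where "D = trunc_mean_deriv k (1 - p)"
  define E where "E = lam * t * (1 - (1 - p) ^ k)"
  define W where "W = (\<lambda>n \<omega>. (\<Sum>j=1..n. \<Sum>i=1..k. (real i - 1 - r) * (real (X i j \<omega>) - m i)) / sqrt (real n))"
  note expansion = mle_expansion[OF M par assms(9,10,11) m_def r_def D_def E_def W_def]
  note p_lim = expansion(3)
  obtain a where a: "((\<lambda>(n, \<omega>). a n \<omega>) \<longlongrightarrow> - (1 / (E * D))) (whp M)"
    "\<forall>\<^sub>F (n, \<omega>) in whp M. sqrt (real n) * (p_hat n \<omega> - p) = a n \<omega> * W n \<omega>"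
    using expansion(4) by blast
  have x: "0 < 1 - p" "1 - p < 1" using par by auto
  have xk: "(1 - p) ^ k < 1" using power_less_one[OF x] par by simp
  have E: "E > 0" using par xk by (simp add: E_def)
  have D: "D > 0" using trunc_mean_deriv_pos[OF x par(1)] by (simp add: D_def)
  have vW: "E * (1 - p) * D \<ge> 0" using E D x by simp
  have var_p: "(- (1 / (E * D)))\<^sup>2 * (E * (1 - p) * D) = var_p k t p lam"
  proof -
    have "(- (1 / (E * D)))\<^sup>2 * (E * (1 - p) * D) = (1 - p) / (E * D)"
      using E D by (simp add: power2_eq_square field_simps)
    \<comment> \<open>By \<open>q_poly_eq\<close>, \<open>D\<close> is \<open>q_poly p k\<close>
      over \<open>p^2 (1 - (1 - p)^k)^2\<close>; one factor \<open>1 - (1 - p)^k\<close> cancels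
      against \<open>E\<close>.\<close>
    also have "\<dots> = var_p k t p lam"
      unfolding var_p_def q_poly_eq[OF par(3,4,1)] E_def D_def[symmetric]
      using par xk D by (simp add: power2_eq_square divide_simps)
    finally show ?thesis .
  qed

  \<comment> \<open>The error of the estimator of \<open>chi\<close> along the rounded sample
    sizes\<close>
  define N where "N = (\<lambda>n. nat \<lceil>\<gamma> * real n\<rceil>)"
  note N = ceiling_index_asymptotics[OF \<gamma> N_def]
  define Y where "Y = (\<lambda>n \<omega>. sqrt (real (N n)) * (chi_hat (N n) \<omega> - chi))"
  have Ym[measurable]: "Y n \<in> borel_measurable M" for n by (simp add: Y_def)
  have Y: "converges_to_normal M Y (sigma_chi\<^sup>2)"
    unfolding Y_def using converges_to_normal_subseq[OF M _ _ assms(14) N(1)] by simp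
  have YW: "indep_var borel (Y n) borel (W n)" for n
    unfolding Y_def W_def by (rule indep_var_poisson_array_sum[OF M assms(9) _ _ assms(13)]) auto
  \<comment> \<open>Nothing is known about \<open>p_hat 0\<close>; the factor \<open>sqrt 0\<close> makes this harmless.\<close>
  have p_meas: "(\<lambda>\<omega>. sqrt (real n) * f \<omega> (p_hat n \<omega>)) \<in> borel_measurable M"
    if "(\<lambda>(\<omega>, y). f \<omega> y) \<in> borel_measurable (M \<Otimes>\<^sub>M borel)" for n and f :: "'a \<Rightarrow> real \<Rightarrow> real"
  proof (cases "n = 0")
    case False
    then have [measurable]: "p_hat n \<in> borel_measurable M" using assms(11)[of n] by (auto simp: is_mle_def)
    note that[measurable]
    show ?thesis by measurable
  qed simp

  \<comment> \<open>The estimator of \<open>p\<close> alone is the combination with coefficient 0 on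
    \<open>Y\<close>.\<close>
  have "converges_to_normal M (\<lambda>n \<omega>. sqrt (real n) * (p_hat n \<omega> - p))
      (0\<^sup>2 * sigma_chi\<^sup>2 + (- (1 / (E * D)))\<^sup>2 * (E * (1 - p) * D))"
  proof (rule converges_to_normal_random_combination[OF M _ vW Ym expansion(2) _ Y expansion(1) YW _ a(1)])
    show "(\<lambda>\<omega>. sqrt (real n) * (p_hat n \<omega> - p)) \<in> borel_measurable M" for n
      by (rule p_meas) measurable
    show "((\<lambda>(n, \<omega>). 0) \<longlongrightarrow> (0::real)) (whp M)" by (rule tendsto_whp_const[OF M tendsto_const])
  qed (use a(2) in auto)
  then have part1: "converges_to_normal M (\<lambda>n \<omega>. sqrt (real n) * (p_hat n \<omega> - p)) (var_p k t p lam)"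
    by (simp only: var_p) simp

  \<comment> \<open>The plug-in estimator of the wavelength\<close>
  define h where "h = (\<lambda>z::real. - ln (1 - z))"
  have "(h has_real_derivative 1 / (1 - p)) (at p)"
    unfolding h_def using x by (auto intro!: derivative_eq_intros)
  then obtain g where g: "\<And>z. h z - h p = g z * (z - p)" "isCont g p" "g p = 1 / (1 - p)"
    unfolding CARAT_DERIV by blast
  have g_lim: "((\<lambda>(n, \<omega>). g (p_hat n \<omega>)) \<longlongrightarrow> 1 / (1 - p)) (whp M)"
    using isCont_tendsto_compose[OF g(2) p_lim] by (simp add: g(3) case_prod_beta')
  have N_pos: "\<forall>\<^sub>F (n, \<omega>) in whp M. N n > 0"
    using eventually_compose_filterlim[OF eventually_gt_at_top[of 0] N(1)]
    by (intro eventually_whpI_sequentially[OF M]) (auto elim: eventually_mono)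
  have "((\<lambda>x. chi + (\<lambda>(n, \<omega>). Y n \<omega> / sqrt (real (N n))) x) \<longlongrightarrow> chi + 0) (whp M)"
    by (intro tendsto_add tendsto_const converges_to_normal_div_sqrt_vanishes[OF M _ Ym Y N(1)]) simp
  then have "((\<lambda>x. chi + (\<lambda>(n, \<omega>). Y n \<omega> / sqrt (real (N n))) x) \<longlongrightarrow> chi) (whp M)" by simp
  then have chi_lim: "((\<lambda>(n, \<omega>). chi_hat (N n) \<omega>) \<longlongrightarrow> chi) (whp M)"
    by (rule Lim_transform_eventually) (use N_pos in \<open>auto simp: Y_def elim!: eventually_mono\<close>)
  \<comment> \<open>An estimate equal to 0 would make the wavelength a division by zero; consistency
    and \<open>chi \<noteq> 0\<close> exclude it with high probability.\<close>
  have chi_ne: "\<forall>\<^sub>F (n, \<omega>) in whp M. chi_hat (N n) \<omega> \<noteq> 0"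
    using tendsto_imp_eventually_ne[OF chi_lim chi] by (simp add: case_prod_beta')

  \<comment> \<open>With \<open>c\<close> the estimate of \<open>chi\<close>, the error
    \<open>h (p_hat) / c - h p / chi\<close> splits exactly into
    \<open>(h (p_hat) - h p) / c\<close> and \<open>- h p * (c - chi) / (chi * c)\<close>. These are
    the coefficients of \<open>W\<close> and \<open>Y\<close> after multiplication by
    \<open>sqrt n\<close>.\<close>
  let ?\<alpha> = "\<lambda>n \<omega>. g (p_hat n \<omega>) / chi_hat (N n) \<omega> * a n \<omega>"
  let ?\<beta> = "\<lambda>n \<omega>. - (h p / (chi * chi_hat (N n) \<omega>)) * (sqrt (real n) / sqrt (real (N n)))"
  let ?\<alpha>lim = "1 / (1 - p) / chi * - (1 / (E * D))" and ?\<beta>lim = "- (h p / (chi * chi)) * (1 / sqrt \<gamma>)"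
  have alpha: "((\<lambda>(n, \<omega>). ?\<alpha> n \<omega>) \<longlongrightarrow> ?\<alpha>lim) (whp M)"
    using tendsto_mult[OF tendsto_divide[OF g_lim chi_lim chi] a(1)] by (simp add: case_prod_beta')
  have "chi * chi \<noteq> 0" using chi by simp
  have beta: "((\<lambda>(n, \<omega>). ?\<beta> n \<omega>) \<longlongrightarrow> ?\<beta>lim) (whp M)"
    using tendsto_mult[OF tendsto_minus[OF tendsto_divide[OF tendsto_const
          tendsto_mult[OF tendsto_const chi_lim] \<open>chi * chi \<noteq> 0\<close>, of "h p"]] tendsto_whp_const[OF M N(2)]]
    by (simp add: case_prod_beta')
  let ?T = "\<lambda>n \<omega>. sqrt (real n) * (wavelength (p_hat n \<omega>) (chi_hat (N n) \<omega>) - wavelength p chi)"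
  have "converges_to_normal M ?T (?\<beta>lim\<^sup>2 * sigma_chi\<^sup>2 + ?\<alpha>lim\<^sup>2 * (E * (1 - p) * D))"
  proof (rule converges_to_normal_random_combination[OF M _ vW Ym expansion(2) _ Y expansion(1) YW beta alpha])
    show "?T n \<in> borel_measurable M" for n
      unfolding wavelength_def by (rule p_meas) measurable
    show "\<forall>\<^sub>F (n, \<omega>) in whp M. ?T n \<omega> = ?\<beta> n \<omega> * Y n \<omega> + ?\<alpha> n \<omega> * W n \<omega>"
      using N_pos chi_ne a(2)
    proof eventually_elim
      case (elim y)
      obtain n \<omega> where y: "y = (n, \<omega>)" by (cases y)
      define c where "c = chi_hat (N n) \<omega>"
      have H: "N n > 0" "c \<noteq> 0" "sqrt (real n) * (p_hat n \<omega> - p) = a n \<omega> * W n \<omega>"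
        using elim by (auto simp: y c_def)
      have "?T n \<omega> = sqrt (real n) * (h (p_hat n \<omega>) / c - h p / chi)"
        by (simp add: wavelength_def h_def c_def)
      also have "\<dots> = sqrt (real n) * ((h (p_hat n \<omega>) - h p) / c) + - (h p / (chi * c)) * sqrt (real n) * (c - chi)"
        using H(2) chi by (simp add: field_simps)
      also have "sqrt (real n) * ((h (p_hat n \<omega>) - h p) / c) = g (p_hat n \<omega>) / c * (a n \<omega> * W n \<omega>)"
        unfolding g(1) H(3)[symmetric] by simp
      \<comment> \<open>\<open>Y\<close> is scaled by \<open>sqrt (N n)\<close> instead of
        \<open>sqrt n\<close>; as \<open>N n > 0\<close>, the ratio of roots in the coefficient
        corrects this.\<close>
      also have "- (h p / (chi * c)) * sqrt (real n) * (c - chi) = ?\<beta> n \<omega> * Y n \<omega>"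
        using H(1) by (simp add: Y_def c_def)
      finally show ?case by (simp add: y c_def)
    qed
  qed simp
  moreover have "?\<beta>lim\<^sup>2 * sigma_chi\<^sup>2 + ?\<alpha>lim\<^sup>2 * (E * (1 - p) * D) = var_wavelength k t p lam chi (sigma_chi\<^sup>2) \<gamma>"
  proof -
    \<comment> \<open>The limiting coefficients contain the partial derivatives of the wavelength:
      that in \<open>p\<close> multiplies \<open>- (1 / (E * D))\<close>, that in \<open>chi\<close>
      multiplies \<open>1 / sqrt \<gamma>\<close>.\<close>
    have "((\<lambda>x. wavelength x chi) has_real_derivative 1 / (1 - p) / chi) (at p)"
      unfolding wavelength_def using x chi by (auto intro!: derivative_eq_intros)
    moreover have "((\<lambda>y. wavelength p y) has_real_derivative - (h p / (chi * chi))) (at chi)"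
      unfolding wavelength_def h_def using chi by (auto intro!: derivative_eq_intros)
    ultimately have "deriv (\<lambda>x. wavelength x chi) p = 1 / (1 - p) / chi"
      "deriv (\<lambda>y. wavelength p y) chi = - (h p / (chi * chi))" by (auto intro: DERIV_imp_deriv)
    then show ?thesis
      using \<gamma> by (simp add: var_wavelength_def var_p[symmetric] power_mult_distrib power_divide)
  qed
  ultimately show ?thesis using part1 by (simp add: N_def)
qed

end
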